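(* Let $(\Omega,\Sigma,\mu)$ be a measure space and let $Y$ be a strictly convex Banach space over $\mathbb K\in\{\mathbb R,\mathbb C\}$ with $\dim(Y)\geq2$. The following statements are equivalent: (i) $\mathrm{NA}_\pi(L_1(\mu)\widehat{\otimes}_\pi Y)=L_1(\mu)\widehat{\otimes}_\pi Y$. (ii) $\mu$ is purely atomic.
   Context: $X\widehat{\otimes}_\pi Y$ denotes the projective tensor product. An element $u\in X\widehat{\otimes}_\pi Y$ attains its projective norm if there are $(x_i)\subseteq X$, $(y_i)\subseteq Y$ with $u=\sum_{i=1}^\infty x_i\otimes y_i$ and $\|u\|_\pi=\sum_{i=1}^\infty\|x_i\|\|y_i\|$; $\mathrm{NA}_\pi(X\widehat{\otimes}_\pi Y)$ is the set of such elements. $Y$ is strictly convex if $\|x+y\|<2$ for all distinct unit vectors $x,y\in Y$. A set $A\in\Sigma$ is an atom if $0<\mu(A)<\infty$ and every measurable $B\subseteq A$ has $\mu(B)=0$ or $\mu(B)=\mu(A)$. A set $E\in\Sigma$ with $0<\mu(E)<\infty$ is purely atomic if it coincides, modulo a null set, with the union of the (countably many, modulo null sets) atoms contained in $E$; $\mu$ is purely atomic if every $E\in\Sigma$ with $0<\mu(E)<\infty$ is purely atomic. *)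

theory Defs
  imports "HOL-Analysis.Analysis" "HOL-Library.Multiset"
begin

text \<open>
  The space \<open>L\<^sub>1(\<mu>)\<close> depends on the term \<open>\<mu>\<close>, so it cannot be a type of its own.
  Normed spaces over a scalar field are therefore records with an explicit carrier set.
  The zero vector and negation are recovered as \<open>0 \<cdot> x\<close> and \<open>(-1) \<cdot> x\<close>.
\<close>

record ('k, 'v) nspace =
  vcarrier :: "'v set"
  vadd :: "'v \<Rightarrow> 'v \<Rightarrow> 'v"
  vscale :: "'k \<Rightarrow> 'v \<Rightarrow> 'v"
  vnorm :: "'v \<Rightarrow> real"

definition vminus :: "('k::real_normed_field, 'v) nspace \<Rightarrow> 'v \<Rightarrow> 'v \<Rightarrow> 'v" where
  "vminus N u v = vadd N u (vscale N (-1) v)"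

primrec vpartial_sum :: "('k::real_normed_field, 'v) nspace \<Rightarrow> (nat \<Rightarrow> 'v) \<Rightarrow> nat \<Rightarrow> 'v" where
  "vpartial_sum N f 0 = f 0"
| "vpartial_sum N f (Suc n) = vadd N (vpartial_sum N f n) (f (Suc n))"

definition vsums :: "('k::real_normed_field, 'v) nspace \<Rightarrow> (nat \<Rightarrow> 'v) \<Rightarrow> 'v \<Rightarrow> bool" where
  "vsums N f u \<longleftrightarrow> (\<lambda>n. vnorm N (vminus N (vpartial_sum N f n) u)) \<longlonglongrightarrow> 0"


subsection \<open>Banach spaces given by a type\<close>

text \<open>
  A real Banach space is a type of class \<^class>\<open>banach\<close>. A complex Banach space is such a type
  with a complex scalar multiplication that extends the real one and is compatible with the norm.
\<close>

locale complex_scaling = vector_space sc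
  for sc :: "complex \<Rightarrow> 'y::real_normed_vector \<Rightarrow> 'y" +
  assumes scale_of_real: "sc (of_real r) y = r *\<^sub>R y"
    and norm_scale: "norm (sc c y) = norm c * norm y"

definition nspace_of ::
    "('k::real_normed_field \<Rightarrow> 'y::real_normed_vector \<Rightarrow> 'y) \<Rightarrow> ('k, 'y) nspace" where
  "nspace_of sc = \<lparr>vcarrier = UNIV, vadd = (+), vscale = sc, vnorm = norm\<rparr>"

text \<open>
  The library function \<^const>\<open>vector_space.dim\<close> is \<open>0\<close> on infinite-dimensional spaces,
  so \<open>dim Y \<ge> n\<close> is expressed by an independent set with \<open>n\<close> elements.
\<close>

definition dim_at_least ::
    "nat \<Rightarrow> ('k::real_normed_field \<Rightarrow> 'y::real_normed_vector \<Rightarrow> 'y) \<Rightarrow> bool" where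
  "dim_at_least n sc \<longleftrightarrow>
     (\<exists>B. finite B \<and> card B = n \<and> \<not> module.dependent sc B)"

definition strictly_convex :: "'y::real_normed_vector itself \<Rightarrow> bool" where
  "strictly_convex _ \<longleftrightarrow>
     (\<forall>x y::'y. norm x = 1 \<longrightarrow> norm y = 1 \<longrightarrow> x \<noteq> y \<longrightarrow> norm (x + y) < 2)"


subsection \<open>The space of integrable functions modulo equality almost everywhere\<close>

definition L1_class ::
    "'a measure \<Rightarrow> ('a \<Rightarrow> 'k::{real_normed_field,banach,second_countable_topology}) \<Rightarrow> ('a \<Rightarrow> 'k) set" where
  "L1_class M f = {g. integrable M g \<and> (AE t in M. g t = f t)}"

definition L1 ::
    "'a measure \<Rightarrow> ('k::{real_normed_field,banach,second_countable_topology}, ('a \<Rightarrow> 'k) set) nspace" where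
  "L1 M =
    \<lparr>vcarrier = L1_class M ` {f. integrable M f},
     vadd = (\<lambda>F G. \<Union>f\<in>F. \<Union>g\<in>G. L1_class M (\<lambda>t. f t + g t)),
     vscale = (\<lambda>c F. \<Union>f\<in>F. L1_class M (\<lambda>t. c * f t)),
     vnorm = (\<lambda>F. THE r. \<exists>f\<in>F. r = (\<integral>t. norm (f t) \<partial>M))\<rparr>"


subsection \<open>The algebraic tensor product with the projective norm\<close>

text \<open>
  A finite multiset of pairs \<open>(x\<^sub>i, y\<^sub>i)\<close> stands for the formal sum of the \<open>x\<^sub>i \<otimes> y\<^sub>i\<close>.
  The algebraic tensor product is the free commutative monoid on pairs modulo the congruence
  generated by the bilinearity relations. Scalars need no separate treatment since
  \<open>c(x \<otimes> y) = (cx) \<otimes> y\<close>, and \<open>((-1)x) \<otimes> y\<close> is the inverse of \<open>x \<otimes> y\<close>.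
\<close>

inductive tensor_cong ::
    "('k::real_normed_field, 'x) nspace \<Rightarrow> ('k, 'y) nspace \<Rightarrow>
     ('x \<times> 'y) multiset \<Rightarrow> ('x \<times> 'y) multiset \<Rightarrow> bool"
  for X :: "('k::real_normed_field, 'x) nspace" and Y :: "('k, 'y) nspace" where
  tc_refl: "set_mset w \<subseteq> vcarrier X \<times> vcarrier Y \<Longrightarrow> tensor_cong X Y w w"
| tc_sym: "tensor_cong X Y v w \<Longrightarrow> tensor_cong X Y w v"
| tc_trans: "tensor_cong X Y u v \<Longrightarrow> tensor_cong X Y v w \<Longrightarrow> tensor_cong X Y u w"
| tc_plus: "tensor_cong X Y v w \<Longrightarrow> tensor_cong X Y v' w' \<Longrightarrow> tensor_cong X Y (v + v') (w + w')"
| tc_add_left: "x \<in> vcarrier X \<Longrightarrow> x' \<in> vcarrier X \<Longrightarrow> y \<in> vcarrier Y \<Longrightarrow>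
    tensor_cong X Y {#(vadd X x x', y)#} {#(x, y), (x', y)#}"
| tc_add_right: "x \<in> vcarrier X \<Longrightarrow> y \<in> vcarrier Y \<Longrightarrow> y' \<in> vcarrier Y \<Longrightarrow>
    tensor_cong X Y {#(x, vadd Y y y')#} {#(x, y), (x, y')#}"
| tc_scale: "x \<in> vcarrier X \<Longrightarrow> y \<in> vcarrier Y \<Longrightarrow>
    tensor_cong X Y {#(vscale X c x, y)#} {#(x, vscale Y c y)#}"
| tc_zero: "x \<in> vcarrier X \<Longrightarrow> y \<in> vcarrier Y \<Longrightarrow> tensor_cong X Y {#(vscale X 0 x, y)#} {#}"

definition tensor_class ::
    "('k::real_normed_field, 'x) nspace \<Rightarrow> ('k, 'y) nspace \<Rightarrow>
     ('x \<times> 'y) multiset \<Rightarrow> ('x \<times> 'y) multiset set" where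
  "tensor_class X Y w = {v. tensor_cong X Y w v}"

text \<open>
  An element of the algebraic tensor product is the set of all its finite representations, so the
  projective norm is the infimum of \<open>\<Sum> \<parallel>x\<^sub>i\<parallel> \<parallel>y\<^sub>i\<parallel>\<close> over the members of that set.
\<close>

definition alg_tensor ::
    "('k::real_normed_field, 'x) nspace \<Rightarrow> ('k, 'y) nspace \<Rightarrow> ('k, ('x \<times> 'y) multiset set) nspace" where
  "alg_tensor X Y =
    \<lparr>vcarrier = tensor_class X Y ` {w. set_mset w \<subseteq> vcarrier X \<times> vcarrier Y},
     vadd = (\<lambda>U V. \<Union>u\<in>U. \<Union>v\<in>V. tensor_class X Y (u + v)),
     vscale = (\<lambda>c U. \<Union>u\<in>U. tensor_class X Y (image_mset (\<lambda>(x, y). (vscale X c x, y)) u)),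
     vnorm = (\<lambda>U. INF u\<in>U. \<Sum>(x, y)\<in>#u. vnorm X x * vnorm Y y)\<rparr>"


subsection \<open>Completion\<close>

definition vcauchy :: "('k::real_normed_field, 'v) nspace \<Rightarrow> (nat \<Rightarrow> 'v) \<Rightarrow> bool" where
  "vcauchy N s \<longleftrightarrow> (\<forall>n. s n \<in> vcarrier N) \<and>
     (\<forall>e>0. \<exists>n0. \<forall>m\<ge>n0. \<forall>n\<ge>n0. vnorm N (vminus N (s m) (s n)) < e)"

definition cauchy_class :: "('k::real_normed_field, 'v) nspace \<Rightarrow> (nat \<Rightarrow> 'v) \<Rightarrow> (nat \<Rightarrow> 'v) set" where
  "cauchy_class N s = {t. vcauchy N t \<and> (\<lambda>n. vnorm N (vminus N (s n) (t n))) \<longlonglongrightarrow> 0}"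

definition vcompletion :: "('k::real_normed_field, 'v) nspace \<Rightarrow> ('k, (nat \<Rightarrow> 'v) set) nspace" where
  "vcompletion N =
    \<lparr>vcarrier = cauchy_class N ` {s. vcauchy N s},
     vadd = (\<lambda>S T. \<Union>s\<in>S. \<Union>t\<in>T. cauchy_class N (\<lambda>n. vadd N (s n) (t n))),
     vscale = (\<lambda>c S. \<Union>s\<in>S. cauchy_class N (\<lambda>n. vscale N c (s n))),
     vnorm = (\<lambda>S. THE r. \<exists>s\<in>S. (\<lambda>n. vnorm N (s n)) \<longlonglongrightarrow> r)\<rparr>"


subsection \<open>The projective tensor product and norm attainment\<close>

type_synonym ('x, 'y) ptensor = "(nat \<Rightarrow> ('x \<times> 'y) multiset set) set"

definition proj_tensor ::
    "('k::real_normed_field, 'x) nspace \<Rightarrow> ('k, 'y) nspace \<Rightarrow> ('k, ('x, 'y) ptensor) nspace" where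
  "proj_tensor X Y = vcompletion (alg_tensor X Y)"

definition elem_tensor ::
    "('k::real_normed_field, 'x) nspace \<Rightarrow> ('k, 'y) nspace \<Rightarrow> 'x \<Rightarrow> 'y \<Rightarrow> ('x, 'y) ptensor" where
  "elem_tensor X Y x y = cauchy_class (alg_tensor X Y) (\<lambda>_. tensor_class X Y {#(x, y)#})"

definition attains_proj_norm ::
    "('k::real_normed_field, 'x) nspace \<Rightarrow> ('k, 'y) nspace \<Rightarrow> ('x, 'y) ptensor \<Rightarrow> bool" where
  "attains_proj_norm X Y u \<longleftrightarrow>
     (\<exists>x y. (\<forall>i. x i \<in> vcarrier X) \<and> (\<forall>i. y i \<in> vcarrier Y) \<and>
        vsums (proj_tensor X Y) (\<lambda>i. elem_tensor X Y (x i) (y i)) u \<and>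
        (\<lambda>i. vnorm X (x i) * vnorm Y (y i)) sums vnorm (proj_tensor X Y) u)"

definition NA_proj ::
    "('k::real_normed_field, 'x) nspace \<Rightarrow> ('k, 'y) nspace \<Rightarrow> ('x, 'y) ptensor set" where
  "NA_proj X Y = {u \<in> vcarrier (proj_tensor X Y). attains_proj_norm X Y u}"


subsection \<open>Purely atomic measures\<close>

definition atom :: "'a measure \<Rightarrow> 'a set \<Rightarrow> bool" where
  "atom M A \<longleftrightarrow> A \<in> sets M \<and> 0 < emeasure M A \<and> emeasure M A < \<infinity> \<and>
     (\<forall>B\<in>sets M. B \<subseteq> A \<longrightarrow> emeasure M B = 0 \<or> emeasure M B = emeasure M A)"

text \<open>
  The family \<open>\<A>\<close> below is a countable family of atoms contained in \<open>E\<close> which contains, up to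
  null sets, every atom contained in \<open>E\<close>; its union is the measurable version of the
  union of all atoms contained in \<open>E\<close>.
\<close>

definition purely_atomic_set :: "'a measure \<Rightarrow> 'a set \<Rightarrow> bool" where
  "purely_atomic_set M E \<longleftrightarrow>
     (\<exists>\<A>. countable \<A> \<and> (\<forall>A\<in>\<A>. atom M A \<and> A \<subseteq> E) \<and>
        (\<forall>B. atom M B \<and> B \<subseteq> E \<longrightarrow> (\<exists>A\<in>\<A>. (A - B) \<union> (B - A) \<in> null_sets M)) \<and>
        (E - \<Union>\<A>) \<union> (\<Union>\<A> - E) \<in> null_sets M)"

definition purely_atomic :: "'a measure \<Rightarrow> bool" where
  "purely_atomic M \<longleftrightarrow>
     (\<forall>E\<in>sets M. 0 < emeasure M E \<and> emeasure M E < \<infinity> \<longrightarrow> purely_atomic_set M E)"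

end

theory Submission
  imports Defs
begin

text \<open>
  A tensor is identified with the function \<open>\<Omega> \<rightarrow> Y\<close> it stands for; its projective norm is then the
  \<open>L\<^sub>1\<close> norm of that function, because a tensor of simple functions can be rewritten over disjoint sets.

  If \<open>\<mu>\<close> is purely atomic, integrable functions are constant on atoms, so an element of the completion
  becomes an absolutely summable sequence in \<open>Y\<close>, and its expansion along the atoms attains the norm.

  If \<open>\<mu>\<close> is not purely atomic, some set \<open>R\<close> of finite positive measure contains no atom and carries a
  function \<open>g\<close> all of whose level sets are null. For independent \<open>y\<^sub>1\<close>, \<open>y\<^sub>2\<close> consider the tensor of the
  function \<open>y\<^sub>1 + g y\<^sub>2\<close> on \<open>R\<close>. If \<open>\<Sum> f\<^sub>i \<otimes> x\<^sub>i\<close> attained its norm, the triangle inequality would be an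
  equality at almost every point, so by strict convexity \<open>y\<^sub>1 + g(t) y\<^sub>2\<close> would be a multiple of one of the
  countably many \<open>x\<^sub>i\<close>. But each \<open>x\<^sub>i\<close> serves only one value of \<open>g\<close>, that is, a null set of points \<open>t\<close>.
\<close>

section \<open>The space \<open>L\<^sub>1\<close>\<close>

text \<open>Attainment is a statement about a completion of a quotient, while strict convexity acts
  at single points. The bridge is to replace infima over representations by integrals
  (\<open>vnorm_alg_tensor\<close>) and norms in the completion by limits of distances between
  representatives (\<open>attains_proj_norm_iff\<close>). An element of the completion is never
  turned into a function: over atoms its limit is formed in l1(Y), and the counterexample has rank
  at most two, so that a constant sequence represents it. The function g stores, as base 3 digits 0
  and 1, the membership of a point in countably many sets which, for every n, cover R up to a null
  set by pieces of measure at most 1/(n+1). Base 3 makes the digits recoverable, so for each n a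
  level set is null or inside one such piece. Dimension two makes y1 + g y2 change its direction
  whenever g changes its value. The measure may fail to be sigma-finite. Pure atomicity only speaks
  about sets of finite measure, so one treats the countably many scalar functions of one Cauchy
  sequence at a time and exhausts their supports by sets of finite measure.\<close>

definition L1_rep :: "('a \<Rightarrow> 'k) set \<Rightarrow> 'a \<Rightarrow> 'k" where
  "L1_rep F = (SOME f. f \<in> F)"

context
  fixes M :: "'a measure"
begin

context
  fixes f :: "'a \<Rightarrow> 'k::{real_normed_field,banach,second_countable_topology}"
  assumes f: "integrable M f"
begin

lemma L1_class_self: "f \<in> L1_class M f"
  using f by (simp add: L1_class_def)

lemma L1_class_in_carrier: "L1_class M f \<in> vcarrier (L1 M)"
  using f by (auto simp: L1_def)

lemma L1_rep_AE: "AE t in M. L1_rep (L1_class M f) t = f t"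
  using someI[of "\<lambda>h. h \<in> L1_class M f", OF L1_class_self] by (simp add: L1_rep_def L1_class_def)

end

lemma integrable_indicator_field:
  assumes "A \<in> sets M" "emeasure M A < \<infinity>"
  shows "integrable M (indicator A :: 'a \<Rightarrow> 'k::{real_normed_field,banach,second_countable_topology})"
proof -
  have "indicator A = (\<lambda>t. of_real (indicator A t) :: 'k)" by (auto simp: indicator_def)
  then show ?thesis using integrable_real_indicator[OF assms] by simp
qed

lemma L1_class_cong:
  fixes f g :: "'a \<Rightarrow> 'k::{real_normed_field,banach,second_countable_topology}"
  assumes "AE t in M. f t = g t"
  shows "L1_class M f = L1_class M g"
proof -
  have "(AE t in M. h t = f t) \<longleftrightarrow> (AE t in M. h t = g t)" for h :: "'a \<Rightarrow> 'k"
    using assms by (auto elim: eventually_elim2)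
  then show ?thesis by (simp add: L1_class_def)
qed

lemma L1_carrier_rep:
  fixes F :: "('a \<Rightarrow> 'k::{real_normed_field,banach,second_countable_topology}) set"
  assumes "F \<in> vcarrier (L1 M)"
  shows "integrable M (L1_rep F)" "L1_class M (L1_rep F) = F"
proof -
  obtain f where f: "integrable M f" "F = L1_class M f" using assms by (auto simp: L1_def)
  have "L1_rep F \<in> F" unfolding L1_rep_def f(2)
    by (rule someI[of "\<lambda>h. h \<in> L1_class M f", OF L1_class_self[OF f(1)]])
  then show "integrable M (L1_rep F)" by (simp add: f(2) L1_class_def)
  show "L1_class M (L1_rep F) = F"
    unfolding f(2) by (rule L1_class_cong[OF L1_rep_AE[OF f(1)]])
qed

lemma L1_vadd:
  fixes f g :: "'a \<Rightarrow> 'k::{real_normed_field,banach,second_countable_topology}"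
  assumes f: "integrable M f" and g: "integrable M g"
  shows "vadd (L1 M) (L1_class M f) (L1_class M g) = L1_class M (\<lambda>t. f t + g t)"
proof -
  have "L1_class M (\<lambda>t. f' t + g' t) = L1_class M (\<lambda>t. f t + g t)"
    if "f' \<in> L1_class M f" "g' \<in> L1_class M g" for f' g'
    using that by (intro L1_class_cong) (auto simp: L1_class_def elim: eventually_elim2)
  then have "(\<Union>f'\<in>L1_class M f. \<Union>g'\<in>L1_class M g. L1_class M (\<lambda>t. f' t + g' t)) =
      L1_class M (\<lambda>t. f t + g t)"
    using L1_class_self[OF f] L1_class_self[OF g] by blast
  then show ?thesis by (simp add: L1_def)
qed

context
  fixes f :: "'a \<Rightarrow> 'k::{real_normed_field,banach,second_countable_topology}"
  assumes f: "integrable M f"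
begin

lemma L1_vscale: "vscale (L1 M) c (L1_class M f) = L1_class M (\<lambda>t. c * f t)"
proof -
  have "L1_class M (\<lambda>t. c * f' t) = L1_class M (\<lambda>t. c * f t)" if "f' \<in> L1_class M f" for f'
    using that by (intro L1_class_cong) (auto simp: L1_class_def)
  then have "(\<Union>f'\<in>L1_class M f. L1_class M (\<lambda>t. c * f' t)) = L1_class M (\<lambda>t. c * f t)"
    using L1_class_self[OF f] by blast
  then show ?thesis by (simp add: L1_def)
qed

lemma L1_vnorm: "vnorm (L1 M) (L1_class M f) = (\<integral>t. norm (f t) \<partial>M)"
proof -
  have "(\<integral>t. norm (f' t) \<partial>M) = (\<integral>t. norm (f t) \<partial>M)" if "f' \<in> L1_class M f" for f'
    using that f by (intro integral_cong_AE) (auto simp: L1_class_def)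
  then have "(THE r. \<exists>f'\<in>L1_class M f. r = (\<integral>t. norm (f' t) \<partial>M)) = (\<integral>t. norm (f t) \<partial>M)"
    using L1_class_self[OF f] by (intro the_equality) blast+
  then show ?thesis by (simp add: L1_def)
qed

end

lemma L1_vadd_closed:
  fixes F G :: "('a \<Rightarrow> 'k::{real_normed_field,banach,second_countable_topology}) set"
  assumes "F \<in> vcarrier (L1 M)" "G \<in> vcarrier (L1 M)"
  shows "vadd (L1 M) F G \<in> vcarrier (L1 M)"
proof -
  note F = L1_carrier_rep[OF assms(1)] and G = L1_carrier_rep[OF assms(2)]
  show ?thesis
    using L1_vadd[OF F(1) G(1)] L1_class_in_carrier[of "\<lambda>t. L1_rep F t + L1_rep G t"] F G by simp
qed

lemma L1_vscale_closed:
  fixes F :: "('a \<Rightarrow> 'k::{real_normed_field,banach,second_countable_topology}) set"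
  assumes "F \<in> vcarrier (L1 M)"
  shows "vscale (L1 M) c F \<in> vcarrier (L1 M)"
proof -
  note F = L1_carrier_rep[OF assms(1)]
  show ?thesis
    using L1_vscale[OF F(1), of c] L1_class_in_carrier[of "\<lambda>t. c * L1_rep F t"] F by simp
qed

lemma L1_rep_vadd:
  fixes F G :: "('a \<Rightarrow> 'k::{real_normed_field,banach,second_countable_topology}) set"
  assumes "F \<in> vcarrier (L1 M)" "G \<in> vcarrier (L1 M)"
  shows "AE t in M. L1_rep (vadd (L1 M) F G) t = L1_rep F t + L1_rep G t"
proof -
  note F = L1_carrier_rep[OF assms(1)] and G = L1_carrier_rep[OF assms(2)]
  show ?thesis
    using L1_vadd[OF F(1) G(1)] L1_rep_AE[of "\<lambda>t. L1_rep F t + L1_rep G t"] F G by simp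
qed

lemma L1_rep_vscale:
  fixes F :: "('a \<Rightarrow> 'k::{real_normed_field,banach,second_countable_topology}) set"
  assumes "F \<in> vcarrier (L1 M)"
  shows "AE t in M. L1_rep (vscale (L1 M) c F) t = c * L1_rep F t"
proof -
  note F = L1_carrier_rep[OF assms(1)]
  show ?thesis
    using L1_vscale[OF F(1), of c] L1_rep_AE[of "\<lambda>t. c * L1_rep F t"] F by simp
qed

lemma L1_vscale_vadd:
  fixes F G :: "('a \<Rightarrow> 'k::{real_normed_field,banach,second_countable_topology}) set"
  assumes "F \<in> vcarrier (L1 M)" "G \<in> vcarrier (L1 M)"
  shows "vscale (L1 M) c (vadd (L1 M) F G) = vadd (L1 M) (vscale (L1 M) c F) (vscale (L1 M) c G)"
proof -
  note F = L1_carrier_rep[OF assms(1)] and G = L1_carrier_rep[OF assms(2)]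
  have "vscale (L1 M) c (vadd (L1 M) (L1_class M (L1_rep F)) (L1_class M (L1_rep G))) =
    vadd (L1 M) (vscale (L1 M) c (L1_class M (L1_rep F))) (vscale (L1 M) c (L1_class M (L1_rep G)))"
    using F(1) G(1) by (simp add: L1_vadd L1_vscale distrib_left)
  then show ?thesis by (simp add: F G)
qed

lemma L1_vscale_vscale:
  fixes F :: "('a \<Rightarrow> 'k::{real_normed_field,banach,second_countable_topology}) set"
  assumes "F \<in> vcarrier (L1 M)"
  shows "vscale (L1 M) c (vscale (L1 M) d F) = vscale (L1 M) (c * d) F"
proof -
  note F = L1_carrier_rep[OF assms(1)]
  have "vscale (L1 M) c (vscale (L1 M) d (L1_class M (L1_rep F))) =
    vscale (L1 M) (c * d) (L1_class M (L1_rep F))"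
    using F(1) by (simp add: L1_vscale mult.assoc)
  then show ?thesis by (simp add: F)
qed

lemma L1_vnorm_rep:
  fixes F :: "('a \<Rightarrow> 'k::{real_normed_field,banach,second_countable_topology}) set"
  assumes "F \<in> vcarrier (L1 M)"
  shows "vnorm (L1 M) F = (\<integral>t. norm (L1_rep F t) \<partial>M)"
  using L1_vnorm[OF L1_carrier_rep(1)[OF assms]] by (simp add: L1_carrier_rep(2)[OF assms])

end

section \<open>The tensor congruence\<close>

lemma tensor_cong_sum:
  assumes "finite I" "\<And>i. i \<in> I \<Longrightarrow> tensor_cong X Y (v i) (w i)"
  shows "tensor_cong X Y (\<Sum>i\<in>I. v i) (\<Sum>i\<in>I. w i)"
  using assms by (induction I rule: finite_induct) (auto intro: tc_plus tc_refl)

lemma tensor_class_eq: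
  assumes "tensor_cong X Y v w"
  shows "tensor_class X Y v = tensor_class X Y w"
  using assms by (auto simp: tensor_class_def intro: tc_trans tc_sym)

text \<open>Indexing the pairs lets each function in a representation receive its own simple
  approximation, even when a pair occurs several times.\<close>

lemma mset_eq_sum_singletons:
  obtains n and p :: "nat \<Rightarrow> 'b" where "w = (\<Sum>i<n. {#p i#})"
proof -
  obtain xs where xs: "mset xs = w" using ex_mset by blast
  have "mset xs = (\<Sum>i<length xs. {#xs ! i#})"
    by (induction xs rule: rev_induct) (auto simp: nth_append intro!: sum.cong)
  then show ?thesis using that xs by blast
qed

text \<open>Treats the real and the complex case at once. The link \<open>scale_real\<close> is what
  later absorbs the real factor coming from strict convexity into a scalar of the field.\<close>

locale scaled_banach = vector_space sc
  for sc :: "'k::{real_normed_field,banach,second_countable_topology} \<Rightarrow> 'y::banach \<Rightarrow> 'y" +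
  assumes scale_real: "sc (of_real r) y = r *\<^sub>R y"
    and norm_sc: "norm (sc c y) = norm c * norm y"
begin

lemma tendsto_sc:
  assumes "(f \<longlongrightarrow> c) F"
  shows "((\<lambda>i. sc (f i) y) \<longlongrightarrow> sc c y) F"
proof -
  have "((\<lambda>i. norm (f i - c) * norm y) \<longlongrightarrow> 0) F"
    by (intro tendsto_mult_left_zero tendsto_norm_zero LIM_zero assms)
  then have "((\<lambda>i. norm (sc (f i) y - sc c y)) \<longlongrightarrow> 0) F"
    by (simp only: scale_left_diff_distrib[symmetric] norm_sc)
  then have "((\<lambda>i. sc (f i) y - sc c y) \<longlongrightarrow> 0) F"
    by (rule tendsto_norm_zero_cancel)
  then show ?thesis by (rule LIM_zero_cancel)
qed

lemma nspace_of_simps [simp]: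
  "vcarrier (nspace_of sc) = UNIV" "vadd (nspace_of sc) = (+)"
  "vscale (nspace_of sc) = sc" "vnorm (nspace_of sc) = norm"
  by (auto simp: nspace_of_def)

end

section \<open>Representations of tensors and their vector-valued functions\<close>

locale L1_tensor = scaled_banach sc
  for sc :: "'k::{real_normed_field,banach,second_countable_topology} \<Rightarrow> 'y::banach \<Rightarrow> 'y" +
  fixes M :: "'a measure"
begin

abbreviation tc where "tc \<equiv> tensor_cong (L1 M) (nspace_of sc)"

abbreviation tclass where "tclass \<equiv> tensor_class (L1 M) (nspace_of sc)"

abbreviation cls :: "('a \<Rightarrow> 'k) \<Rightarrow> ('a \<Rightarrow> 'k) set" where "cls \<equiv> L1_class M"

definition wf_rep :: "(('a \<Rightarrow> 'k) set \<times> 'y) multiset \<Rightarrow> bool" where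
  "wf_rep w \<longleftrightarrow> (\<forall>p\<in>#w. fst p \<in> vcarrier (L1 M))"

text \<open>Both the tensors and the functions \<open>\<Omega> \<rightarrow> Y\<close> they stand for are handled through representatives,
  since the library has Bochner integrals only for second countable \<open>Y\<close>.\<close>

definition tfun :: "(('a \<Rightarrow> 'k) set \<times> 'y) multiset \<Rightarrow> 'a \<Rightarrow> 'y" where
  "tfun w t = (\<Sum>p\<in>#w. sc (L1_rep (fst p) t) (snd p))"

definition tscale :: "'k \<Rightarrow> (('a \<Rightarrow> 'k) set \<times> 'y) multiset \<Rightarrow> (('a \<Rightarrow> 'k) set \<times> 'y) multiset" where
  "tscale c w = image_mset (\<lambda>(x, y). (vscale (L1 M) c x, y)) w"

lemma wf_rep_iff: "wf_rep w \<longleftrightarrow> set_mset w \<subseteq> vcarrier (L1 M) \<times> vcarrier (nspace_of sc)"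
  by (auto simp: wf_rep_def)

lemma wf_rep_empty [simp]: "wf_rep {#}"
  and wf_rep_add_mset [simp]: "wf_rep (add_mset p w) \<longleftrightarrow> fst p \<in> vcarrier (L1 M) \<and> wf_rep w"
  and wf_rep_plus [simp]: "wf_rep (v + w) \<longleftrightarrow> wf_rep v \<and> wf_rep w"
  by (auto simp: wf_rep_def)

lemma wf_rep_sum: "finite I \<Longrightarrow> wf_rep (\<Sum>i\<in>I. w i) \<longleftrightarrow> (\<forall>i\<in>I. wf_rep (w i))"
  by (induction I rule: finite_induct) auto

lemma wf_rep_tscale [simp]: "wf_rep w \<Longrightarrow> wf_rep (tscale c w)"
  by (auto simp: wf_rep_def tscale_def L1_vscale_closed)

lemma tc_wf: "tc v w \<Longrightarrow> wf_rep v \<and> wf_rep w"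
  by (induction rule: tensor_cong.induct)
    (auto simp: wf_rep_iff[THEN iffD2] L1_vadd_closed L1_vscale_closed)

lemma tc_refl': "wf_rep w \<Longrightarrow> tc w w"
  by (intro tc_refl) (simp add: wf_rep_iff)

lemma tfun_empty [simp]: "tfun {#} t = 0"
  and tfun_add_mset [simp]: "tfun (add_mset p w) t = sc (L1_rep (fst p) t) (snd p) + tfun w t"
  and tfun_plus [simp]: "tfun (v + w) t = tfun v t + tfun w t"
  by (auto simp: tfun_def)

lemma tfun_sum: "finite I \<Longrightarrow> tfun (\<Sum>i\<in>I. w i) t = (\<Sum>i\<in>I. tfun (w i) t)"
  by (induction I rule: finite_induct) auto

lemma tscale_empty [simp]: "tscale c {#} = {#}"
  and tscale_add_mset [simp]: "tscale c (add_mset p w) = add_mset (vscale (L1 M) c (fst p), snd p) (tscale c w)"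
  and tscale_plus [simp]: "tscale c (v + w) = tscale c v + tscale c w"
  by (auto simp: tscale_def case_prod_unfold)

lemma tfun_cls: "integrable M f \<Longrightarrow> AE t in M. tfun {#(cls f, y)#} t = sc (f t) y"
  by (drule L1_rep_AE) auto

lemma tfun_tscale:
  assumes "wf_rep w"
  shows "AE t in M. tfun (tscale c w) t = sc c (tfun w t)"
  using assms
proof (induction w)
  case (add p w)
  then have "fst p \<in> vcarrier (L1 M)" "wf_rep w" by auto
  from L1_rep_vscale[OF this(1), of c] add.IH[OF this(2)] show ?case
    by eventually_elim (simp add: scale_right_distrib)
qed simp

text \<open>Scalar multiplication in \<open>alg_tensor\<close> is a union over representatives, so
  it must respect the congruence. Each generating relation is mapped to a relation of the same kind;
  for \<open>tc_scale\<close> this uses that scalars commute.\<close>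

lemma tc_tscale: "tc v w \<Longrightarrow> tc (tscale c v) (tscale c w)"
proof (induction rule: tensor_cong.induct)
  case (tc_refl w)
  then have "wf_rep w" by (simp add: wf_rep_iff)
  then show ?case by (intro tc_refl' wf_rep_tscale)
next
  case (tc_scale x y d)
  have "tc {#(vscale (L1 M) d (vscale (L1 M) c x), y)#} {#(vscale (L1 M) c x, vscale (nspace_of sc) d y)#}"
    using tc_scale by (intro tensor_cong.tc_scale) (auto simp: L1_vscale_closed)
  then show ?case using tc_scale by (simp add: L1_vscale_vscale mult.commute)
next
  case (tc_zero x y)
  have "tc {#(vscale (L1 M) 0 (vscale (L1 M) c x), y)#} {#}"
    using tc_zero by (intro tensor_cong.tc_zero) (auto simp: L1_vscale_closed)
  then show ?case using tc_zero by (simp add: L1_vscale_vscale)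
next
  case (tc_add_left x x' y)
  then show ?case
    using tensor_cong.tc_add_left[of "vscale (L1 M) c x" "L1 M" "vscale (L1 M) c x'" y "nspace_of sc"]
    by (simp add: L1_vscale_vadd L1_vscale_closed)
next
  case (tc_add_right x y y')
  then show ?case
    using tensor_cong.tc_add_right[of "vscale (L1 M) c x" "L1 M" y "nspace_of sc" y']
    by (simp add: L1_vscale_closed)
qed (auto intro: tc_sym tc_trans tc_plus)

lemma tc_tfun: "tc v w \<Longrightarrow> AE t in M. tfun v t = tfun w t"
proof (induction rule: tensor_cong.induct)
  case (tc_sym v w)
  then show ?case by auto
next
  case (tc_trans u v w)
  then show ?case by (auto elim: eventually_elim2)
next
  case (tc_plus v w v' w')
  from tc_plus.IH show ?case by eventually_elim simp
next
  case (tc_add_left x x' y)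
  then show ?case using L1_rep_vadd[of x M x'] by (auto simp: scale_left_distrib)
next
  case (tc_add_right x y y')
  then show ?case by (auto simp: scale_right_distrib)
next
  case (tc_scale x y c)
  then show ?case using L1_rep_vscale[of x M c] by (auto simp: mult.commute)
next
  case (tc_zero x y)
  then show ?case using L1_rep_vscale[of x M 0] by auto
qed simp

subsection \<open>The projective norm\<close>

abbreviation cost :: "(('a \<Rightarrow> 'k) set \<times> 'y) multiset \<Rightarrow> real" where
  "cost w \<equiv> \<Sum>(x, y)\<in>#w. vnorm (L1 M) x * vnorm (nspace_of sc) y"

text \<open>The strong form of measurability, suited to a possibly nonseparable \<open>'y\<close>:
  norms of \<open>tfun\<close>, and of differences of two such functions, become limits of real
  simple functions.\<close>

lemma tfun_approx_simple:
  assumes "wf_rep w"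
  shows "\<exists>s. (\<forall>i. simple_function M (s i)) \<and> (\<forall>t\<in>space M. (\<lambda>i. s i t) \<longlonglongrightarrow> tfun w t)"
  using assms
proof (induction w)
  case empty
  show ?case by (intro exI[of _ "\<lambda>_ _. 0"]) simp
next
  case (add p w)
  then obtain s where s: "\<And>i. simple_function M (s i)" "\<And>t. t \<in> space M \<Longrightarrow> (\<lambda>i. s i t) \<longlonglongrightarrow> tfun w t"
    by auto
  have "L1_rep (fst p) \<in> borel_measurable M"
    using add.prems L1_carrier_rep(1)[of "fst p" M] by auto
  then obtain r where r: "\<And>i. simple_function M (r i)"
    "\<And>t. t \<in> space M \<Longrightarrow> (\<lambda>i. r i t) \<longlonglongrightarrow> L1_rep (fst p) t"
    using borel_measurable_implies_sequence_metric[of "L1_rep (fst p)" M 0] by blast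
  show ?case
  proof (intro exI[of _ "\<lambda>i t. sc (r i t) (snd p) + s i t"] conjI allI ballI)
    show "simple_function M (\<lambda>t. sc (r i t) (snd p) + s i t)" for i
      using r(1) s(1) by (rule simple_function_compose2)
    show "(\<lambda>i. sc (r i t) (snd p) + s i t) \<longlonglongrightarrow> tfun (add_mset p w) t" if "t \<in> space M" for t
      unfolding tfun_add_mset by (intro tendsto_add tendsto_sc r(2) s(2) that)
  qed
qed

lemma norm_tfun_measurable:
  assumes "wf_rep w"
  shows "(\<lambda>t. norm (tfun w t)) \<in> borel_measurable M"
proof -
  obtain s where s: "\<And>i. simple_function M (s i)" "\<And>t. t \<in> space M \<Longrightarrow> (\<lambda>i. s i t) \<longlonglongrightarrow> tfun w t"
    using tfun_approx_simple[OF assms] by auto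
  have "(\<lambda>t. norm (s i t)) \<in> borel_measurable M" for i
    by (intro borel_measurable_simple_function simple_function_compose1[OF s(1)])
  then show ?thesis
    by (rule borel_measurable_LIMSEQ_metric) (rule tendsto_norm[OF s(2)])
qed

text \<open>The pointwise triangle inequality, integrated. Since it holds for every representation,
  it is the lower bound for the projective norm.\<close>

lemma tfun_bound:
  assumes "wf_rep w"
  shows "integrable M (\<lambda>t. norm (tfun w t)) \<and> (\<integral>t. norm (tfun w t) \<partial>M) \<le> cost w"
  using assms
proof (induction w)
  case (add p w)
  then have w: "wf_rep w" and int: "integrable M (\<lambda>t. norm (tfun w t))" "(\<integral>t. norm (tfun w t) \<partial>M) \<le> cost w"
    and p: "fst p \<in> vcarrier (L1 M)" by auto
  note f = L1_carrier_rep[OF p]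
  let ?b = "\<lambda>t. norm (L1_rep (fst p) t) * norm (snd p) + norm (tfun w t)"
  have bint: "integrable M ?b" using int f by auto
  have le: "norm (tfun (add_mset p w) t) \<le> ?b t" for t
    using norm_triangle_ineq[of "sc (L1_rep (fst p) t) (snd p)" "tfun w t"] by (simp add: norm_sc)
  have i: "integrable M (\<lambda>t. norm (tfun (add_mset p w) t))"
    by (rule Bochner_Integration.integrable_bound[OF bint])
      (use norm_tfun_measurable[OF add.prems] le in auto)
  have "(\<integral>t. norm (tfun (add_mset p w) t) \<partial>M) \<le> (\<integral>t. ?b t \<partial>M)"
    by (rule integral_mono[OF i bint le])
  also have "\<dots> = (\<integral>t. norm (L1_rep (fst p) t) \<partial>M) * norm (snd p) + (\<integral>t. norm (tfun w t) \<partial>M)"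
    using f int by (subst Bochner_Integration.integral_add) auto
  also have "\<dots> \<le> cost (add_mset p w)"
    using int(2) by (simp add: case_prod_unfold L1_vnorm_rep[OF p])
  finally show ?case using i by blast
qed simp

lemmas integrable_norm_tfun = conjunct1[OF tfun_bound]
  and integral_norm_tfun_le = conjunct2[OF tfun_bound]

end

context L1_tensor
begin

definition tnorm :: "(('a \<Rightarrow> 'k) set \<times> 'y) multiset \<Rightarrow> real" where
  "tnorm w = (\<integral>t. norm (tfun w t) \<partial>M)"

lemma tnorm_cong:
  assumes "wf_rep v" "wf_rep w" "AE t in M. tfun v t = tfun w t"
  shows "tnorm v = tnorm w"
  unfolding tnorm_def using assms
  by (intro integral_cong_AE norm_tfun_measurable) auto

lemma tnorm_triangle:
  assumes "wf_rep v" "wf_rep w"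
  shows "tnorm (v + w) \<le> tnorm v + tnorm w"
proof -
  have "tnorm (v + w) \<le> (\<integral>t. norm (tfun v t) + norm (tfun w t) \<partial>M)"
    unfolding tnorm_def using assms
    by (intro integral_mono Bochner_Integration.integrable_add integrable_norm_tfun)
      (auto intro: norm_triangle_ineq)
  also have "\<dots> = tnorm v + tnorm w"
    unfolding tnorm_def using assms
    by (intro Bochner_Integration.integral_add integrable_norm_tfun)
  finally show ?thesis .
qed

lemma tnorm_tscale:
  assumes "wf_rep w"
  shows "tnorm (tscale c w) = norm c * tnorm w"
proof -
  have "tnorm (tscale c w) = (\<integral>t. norm c * norm (tfun w t) \<partial>M)"
    unfolding tnorm_def
  proof (intro integral_cong_AE norm_tfun_measurable borel_measurable_times borel_measurable_const)
    show "AE t in M. norm (tfun (tscale c w) t) = norm c * norm (tfun w t)"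
      using tfun_tscale[OF assms, of c] by eventually_elim (simp only: norm_sc)
  qed (use assms in simp_all)
  then show ?thesis by (simp add: tnorm_def)
qed

lemma cost_sum: "finite I \<Longrightarrow> cost (\<Sum>i\<in>I. w i) = (\<Sum>i\<in>I. cost (w i))"
  by (induction I rule: finite_induct) auto

text \<open>Zero in either factor is written as a multiple by the scalar 0; for a zero vector,
  \<open>tc_scale\<close> moves that scalar to the function, where \<open>tc_zero\<close>
  applies.\<close>

lemma tc_null:
  assumes "y = 0 \<or> (AE t in M. f t = 0)" "integrable M f"
  shows "tc {#(cls f, y)#} {#}"
  using assms(1)
proof
  assume "AE t in M. f t = 0"
  then have "cls f = cls (\<lambda>t. 0 * f t)" by (intro L1_class_cong) simp
  also have "\<dots> = vscale (L1 M) 0 (cls f)" using assms(2) by (simp add: L1_vscale)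
  finally show ?thesis
    using tc_zero[of "cls f" "L1 M" y "nspace_of sc"] assms(2) by (simp add: L1_class_in_carrier)
next
  assume "y = 0"
  have "tc {#(vscale (L1 M) 0 (cls f), 0)#} {#(cls f, vscale (nspace_of sc) 0 0)#}"
    using assms(2) by (intro tc_scale) (auto simp: L1_class_in_carrier)
  moreover have "tc {#(vscale (L1 M) 0 (cls f), 0)#} {#}"
    using assms(2) by (intro tc_zero) (auto simp: L1_class_in_carrier)
  ultimately show ?thesis using \<open>y = 0\<close> by (auto intro: tc_sym tc_trans)
qed

lemma tc_add_fun:
  assumes "integrable M f" "integrable M g"
  shows "tc {#(cls (\<lambda>t. f t + g t), y)#} ({#(cls f, y)#} + {#(cls g, y)#})"
  using tc_add_left[of "cls f" "L1 M" "cls g" y "nspace_of sc"] assms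
  by (simp add: L1_class_in_carrier L1_vadd add_mset_commute)

lemma tc_add_vec:
  assumes "integrable M f"
  shows "tc {#(cls f, y + z)#} ({#(cls f, y)#} + {#(cls f, z)#})"
  using tc_add_right[of "cls f" "L1 M" y "nspace_of sc" z] assms
  by (simp add: L1_class_in_carrier add_mset_commute)

lemma tc_scale_fun:
  assumes "integrable M f"
  shows "tc {#(cls (\<lambda>t. c * f t), y)#} {#(cls f, sc c y)#}"
  using tc_scale[of "cls f" "L1 M" y "nspace_of sc" c] assms
  by (simp add: L1_class_in_carrier L1_vscale)

lemma tc_sum_fun:
  assumes "finite I" "\<And>i. i \<in> I \<Longrightarrow> integrable M (f i)"
  shows "tc {#(cls (\<lambda>t. \<Sum>i\<in>I. f i t), y)#} (\<Sum>i\<in>I. {#(cls (f i), y)#})"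
  using assms
proof (induction I rule: finite_induct)
  case empty
  show ?case by (simp add: tc_null)
next
  case (insert i I)
  have "tc {#(cls (\<lambda>t. f i t + (\<Sum>i\<in>I. f i t)), y)#}
      ({#(cls (f i), y)#} + {#(cls (\<lambda>t. \<Sum>i\<in>I. f i t), y)#})"
    using insert by (intro tc_add_fun) auto
  moreover have "tc ({#(cls (f i), y)#} + {#(cls (\<lambda>t. \<Sum>i\<in>I. f i t), y)#})
      ({#(cls (f i), y)#} + (\<Sum>i\<in>I. {#(cls (f i), y)#}))"
    using insert by (intro tc_plus tc_refl') (auto simp: L1_class_in_carrier)
  ultimately show ?case using insert by (auto intro: tc_trans)
qed

lemma tc_sum_vec:
  assumes "finite I" "integrable M f"
  shows "tc {#(cls f, \<Sum>i\<in>I. y i)#} (\<Sum>i\<in>I. {#(cls f, y i)#})"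
  using assms
proof (induction I rule: finite_induct)
  case empty
  then show ?case by (simp add: tc_null)
next
  case (insert i I)
  have "tc {#(cls f, y i + (\<Sum>i\<in>I. y i))#} ({#(cls f, y i)#} + {#(cls f, \<Sum>i\<in>I. y i)#})"
    using insert by (intro tc_add_vec) auto
  moreover have "tc ({#(cls f, y i)#} + {#(cls f, \<Sum>i\<in>I. y i)#})
      ({#(cls f, y i)#} + (\<Sum>i\<in>I. {#(cls f, y i)#}))"
    using insert by (intro tc_plus tc_refl') (auto simp: L1_class_in_carrier)
  ultimately show ?case using insert by (auto intro: tc_trans)
qed

text \<open>Regrouping along the level sets of the joint function \<open>t \<mapsto> (s\<^sub>i t)\<^sub>i\<close> yields a representation
  with disjoint supports, whose cost is the integral of the norm.\<close>

lemma tc_simple_disjoint: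
  fixes s :: "nat \<Rightarrow> 'a \<Rightarrow> 'k"
  assumes s: "\<And>i. i < n \<Longrightarrow> Bochner_Integration.simple_bochner_integrable M (s i)"
  shows "\<exists>v. tc (\<Sum>i<n. {#(cls (s i), y i)#}) v \<and> cost v = tnorm v"
proof -
  \<comment> \<open>Padding with 0 beyond \<open>n\<close> leaves only finitely many joint
    values.\<close>
  define p where "p t = (\<lambda>i. if i < n then s i t else 0)" for t
  \<comment> \<open>The zero value is removed because its level set may have infinite measure. Any
    other level set lies where some \<open>s i\<close> is nonzero, hence has finite measure.\<close>
  define V where "V = p ` space M - {\<lambda>_. 0}"
  define C where "C v = {t \<in> space M. p t = v}" for v
  \<comment> \<open>The value of the tensor on the level set \<open>C v\<close>.\<close>
  define z where "z v = (\<Sum>i<n. sc (v i) (y i))" for v :: "nat \<Rightarrow> 'k"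
  have sf: "simple_function M (s i)" and fin: "emeasure M {t \<in> space M. s i t \<noteq> 0} \<noteq> \<infinity>" if "i < n" for i
    using s[OF that] unfolding simple_bochner_integrable.simps by auto
  have int: "integrable M (s i)" if "i < n" for i
    using s[OF that] by (rule integrableI_simple_bochner_integrable)
  have "finite (p ` space M)"
  proof (rule finite_subset)
    show "p ` space M \<subseteq> {v. \<forall>i. (i \<in> {..<n} \<longrightarrow> v i \<in> (\<Union>j<n. s j ` space M)) \<and> (i \<notin> {..<n} \<longrightarrow> v i = 0)}"
      by (auto simp: p_def; blast)
    show "finite \<dots>"
      using sf by (intro finite_set_of_finite_funs) (auto simp: simple_functionD(1))
  qed
  then have V: "finite V" by (simp add: V_def)
  have C_sets: "C v \<in> sets M" if v: "v \<in> V" for v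
  proof -
    obtain t0 where t0: "v = p t0" using v unfolding V_def by blast
    have "C v = {t \<in> space M. \<forall>i\<in>{..<n}. s i t = v i}"
      by (auto simp: C_def t0 p_def fun_eq_iff)
    moreover have "\<dots> \<in> sets M"
    proof (rule sets.sets_Collect_finite_All)
      show "{t \<in> space M. s i t = v i} \<in> sets M" if "i \<in> {..<n}" for i
        using simple_functionD(2)[OF sf, of i "{v i}"] that
        by (auto simp: vimage_def Int_def conj_commute)
    qed auto
    ultimately show ?thesis by simp
  qed
  have C_fin: "emeasure M (C v) < \<infinity>" if v: "v \<in> V" for v
  proof -
    obtain i where i: "i < n" "v i \<noteq> 0" using v by (auto simp: V_def p_def fun_eq_iff split: if_splits)
    have "{t \<in> space M. s i t \<noteq> 0} = s i -` (- {0}) \<inter> space M" by auto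
    then have "{t \<in> space M. s i t \<noteq> 0} \<in> sets M"
      using simple_functionD(2)[OF sf[OF i(1)], of "- {0}"] by simp
    then have "emeasure M (C v) \<le> emeasure M {t \<in> space M. s i t \<noteq> 0}"
      using i by (intro emeasure_mono) (auto simp: C_def p_def)
    then show ?thesis using fin[OF i(1)] by (auto simp: top.not_eq_extremum)
  qed
  have ind: "integrable M (indicator (C v) :: 'a \<Rightarrow> 'k)" if "v \<in> V" for v
    using C_sets[OF that] C_fin[OF that] by (rule integrable_indicator_field)
  \<comment> \<open>Level sets are disjoint, so at most one summand survives at each point.\<close>
  have single: "(\<Sum>v\<in>V. g v * indicator (C v) t) = (if p t \<in> V then g (p t) else 0)"
    if "t \<in> space M" for g :: "(nat \<Rightarrow> 'k) \<Rightarrow> 'b::real_normed_field" and t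
  proof -
    have "(\<Sum>v\<in>V. g v * indicator (C v) t) = (\<Sum>v\<in>V. if p t = v then g v else 0)"
      using that by (intro sum.cong) (auto simp: C_def indicator_def)
    then show ?thesis using V by simp
  qed
  have out: "p t = (\<lambda>_. 0)" if "t \<in> space M" "p t \<notin> V" for t
    using that by (auto simp: V_def)
  have tc1: "tc {#(cls (s i), y i)#} (\<Sum>v\<in>V. {#(cls (indicator (C v)), sc (v i) (y i))#})"
    if i: "i < n" for i
  proof -
    have "s i t = (\<Sum>v\<in>V. v i * indicator (C v) t)" if "t \<in> space M" for t
      using single[OF that, of "\<lambda>v. v i"] fun_cong[OF out[OF that], of i] i
      by (cases "p t \<in> V") (auto simp: p_def)
    then have "cls (s i) = cls (\<lambda>t. \<Sum>v\<in>V. v i * indicator (C v) t)"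
      by (intro L1_class_cong AE_I2)
    moreover have "tc {#(cls (\<lambda>t. \<Sum>v\<in>V. v i * indicator (C v) t), y i)#}
        (\<Sum>v\<in>V. {#(cls (\<lambda>t. v i * indicator (C v) t), y i)#})"
      using V ind by (intro tc_sum_fun) auto
    moreover have "tc (\<Sum>v\<in>V. {#(cls (\<lambda>t. v i * indicator (C v) t), y i)#})
        (\<Sum>v\<in>V. {#(cls (indicator (C v)), sc (v i) (y i))#})"
      using V ind by (intro tensor_cong_sum tc_scale_fun)
    ultimately show ?thesis by (auto intro: tc_trans)
  qed
  define w where "w = (\<Sum>v\<in>V. {#(cls (indicator (C v)), z v)#})"
  have "tc (\<Sum>i<n. {#(cls (s i), y i)#}) (\<Sum>i<n. \<Sum>v\<in>V. {#(cls (indicator (C v)), sc (v i) (y i))#})"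
    using tc1 by (intro tensor_cong_sum) auto
  \<comment> \<open>Expanding each \<open>z v\<close> gives the same double sum as above with the
    order of summation exchanged.\<close>
  moreover have "tc w (\<Sum>v\<in>V. \<Sum>i<n. {#(cls (indicator (C v)), sc (v i) (y i))#})"
    unfolding w_def z_def using V ind by (intro tensor_cong_sum tc_sum_vec) auto
  ultimately have tc: "tc (\<Sum>i<n. {#(cls (s i), y i)#}) w"
    by (subst (asm) sum.swap) (auto intro: tc_trans tc_sym)
  have wf: "wf_rep w" using tc_wf[OF tc] by simp
  have "AE t in M. \<forall>v\<in>V. tfun {#(cls (indicator (C v)), z v)#} t = sc (indicator (C v) t) (z v)"
    using V ind by (intro AE_finite_allI tfun_cls) auto
  then have "AE t in M. norm (tfun w t) = (\<Sum>v\<in>V. norm (z v) * indicator (C v) t)"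
    using AE_space
  proof eventually_elim
    case (elim t)
    have "tfun w t = (\<Sum>v\<in>V. sc (indicator (C v) t) (z v))"
      unfolding w_def tfun_sum[OF V] using elim(1) by (intro sum.cong) blast+
    also have "\<dots> = (\<Sum>v\<in>V. if p t = v then z v else 0)"
      using elim by (intro sum.cong) (auto simp: C_def indicator_def)
    also have "norm \<dots> = (\<Sum>v\<in>V. norm (z v) * indicator (C v) t)"
      using V single[OF elim(2), of "\<lambda>v. norm (z v)"] by simp
    finally show ?case .
  qed
  then have "tnorm w = (\<integral>t. (\<Sum>v\<in>V. norm (z v) * indicator (C v) t) \<partial>M)"
    unfolding tnorm_def using V C_sets wf
    by (intro integral_cong_AE norm_tfun_measurable borel_measurable_sum borel_measurable_times
        borel_measurable_indicator borel_measurable_const) auto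
  also have "\<dots> = (\<Sum>v\<in>V. norm (z v) * measure M (C v))"
    using V C_sets C_fin by (subst Bochner_Integration.integral_sum) auto
  also have "\<dots> = cost w"
    unfolding w_def cost_sum[OF V]
  proof (intro sum.cong refl)
    fix v assume v: "v \<in> V"
    have "vnorm (L1 M) (cls (indicator (C v) :: 'a \<Rightarrow> 'k)) = (\<integral>t. indicator (C v) t \<partial>M)"
      unfolding L1_vnorm[OF ind[OF v]]
      by (intro Bochner_Integration.integral_cong) (auto split: split_indicator)
    then show "norm (z v) * measure M (C v) = cost {#(cls (indicator (C v)), z v)#}"
      using C_sets[OF v] by (simp add: mult.commute)
  qed
  finally show ?thesis using tc by auto
qed

lemma integrable_simple_approx:
  fixes f :: "'a \<Rightarrow> 'k"
  assumes "integrable M f" "0 < e"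
  shows "\<exists>s. Bochner_Integration.simple_bochner_integrable M s \<and> (\<integral>t. norm (f t - s t) \<partial>M) < e"
proof -
  obtain x where "has_bochner_integral M f x" using assms(1) by (auto elim: integrable.cases)
  then obtain s where s: "\<And>i. Bochner_Integration.simple_bochner_integrable M (s i)"
    and lim: "(\<lambda>i. \<integral>\<^sup>+t. norm (f t - s i t) \<partial>M) \<longlonglongrightarrow> 0"
    unfolding has_bochner_integral.simps by blast
  have "\<forall>\<^sub>F i in sequentially. (\<integral>\<^sup>+t. norm (f t - s i t) \<partial>M) < ennreal e"
    using lim assms(2) by (intro order_tendstoD(2)) auto
  then obtain i where i: "(\<integral>\<^sup>+t. norm (f t - s i t) \<partial>M) < ennreal e"
    by (auto dest: eventually_happens)
  have "integrable M (\<lambda>t. norm (f t - s i t))"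
    using assms(1) integrableI_simple_bochner_integrable[OF s[of i]] by auto
  then have "ennreal (\<integral>t. norm (f t - s i t) \<partial>M) < ennreal e"
    using i by (subst nn_integral_eq_integral[symmetric]) auto
  then show ?thesis using s[of i] by (auto simp: ennreal_less_iff)
qed

text \<open>Split \<open>w\<close> into a simple part \<open>S\<close> and an error
  \<open>E\<close>, and rewrite \<open>S\<close> over disjoint sets. The error is paid twice, once
  as \<open>E\<close> itself and once in \<open>tnorm S\<close>, which is at most
  \<open>tnorm w + cost E\<close>; hence the target \<open>e / 2\<close> for its cost.\<close>

lemma cost_approx:
  assumes w: "wf_rep w" and e: "0 < e"
  shows "\<exists>v. tc w v \<and> cost v \<le> tnorm w + e"
proof -
  obtain n and p :: "nat \<Rightarrow> ('a \<Rightarrow> 'k) set \<times> 'y" where p: "w = (\<Sum>i<n. {#p i#})"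
    by (rule mset_eq_sum_singletons[of w])
  define f where "f i = L1_rep (fst (p i))" for i
  define y where "y i = snd (p i)" for i
  have "fst (p i) \<in> vcarrier (L1 M)" if "i < n" for i
    using w that by (simp add: p wf_rep_sum)
  then have f: "integrable M (f i)" and pf: "p i = (cls (f i), y i)" if "i < n" for i
    using that L1_carrier_rep[of "fst (p i)" M] by (auto simp: f_def y_def)
  \<comment> \<open>Chosen so that each of the \<open>n\<close> error terms costs at most
    \<open>e / 2 / (n + 1)\<close>. The added ones keep the denominators positive when
    \<open>n\<close> or \<open>y i\<close> is zero.\<close>
  define d where "d i = e / 2 / ((real n + 1) * (norm (y i) + 1))" for i
  have d: "0 < d i" for i
    unfolding d_def using e by (intro divide_pos_pos mult_pos_pos) (auto simp: add_nonneg_pos)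
  have "\<exists>s. Bochner_Integration.simple_bochner_integrable M s \<and> (\<integral>t. norm (f i t - s t) \<partial>M) < d i" if "i < n" for i
    using f[OF that] d by (rule integrable_simple_approx)
  then obtain s where s: "\<And>i. i < n \<Longrightarrow> Bochner_Integration.simple_bochner_integrable M (s i)"
    and sd: "\<And>i. i < n \<Longrightarrow> (\<integral>t. norm (f i t - s i t) \<partial>M) < d i" by metis
  have si: "integrable M (s i)" if "i < n" for i
    using s[OF that] by (rule integrableI_simple_bochner_integrable)
  define E where "E = (\<Sum>i<n. {#(cls (\<lambda>t. f i t - s i t), y i)#})"
  define S where "S = (\<Sum>i<n. {#(cls (s i), y i)#})"
  have "tc w (\<Sum>i<n. {#(cls (\<lambda>t. f i t - s i t), y i)#} + {#(cls (s i), y i)#})"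
    unfolding p
  proof (intro tensor_cong_sum finite_lessThan)
    fix i assume "i \<in> {..<n}"
    then have "i < n" by simp
    then show "tc {#p i#} ({#(cls (\<lambda>t. f i t - s i t), y i)#} + {#(cls (s i), y i)#})"
      using tc_add_fun[of "\<lambda>t. f i t - s i t" "s i" "y i"] f si by (simp add: pf)
  qed
  then have tcw: "tc w (E + S)" unfolding E_def S_def by (simp only: sum.distrib)
  have wf: "wf_rep E" "wf_rep S" using tc_wf[OF tcw] by auto
  obtain v where v: "tc S v" "cost v = tnorm v"
    unfolding S_def using tc_simple_disjoint[of n s y] s by blast
  have "cost E = (\<Sum>i<n. (\<integral>t. norm (f i t - s i t) \<partial>M) * norm (y i))"
    unfolding E_def by (subst cost_sum) (use f si in \<open>auto simp: L1_vnorm\<close>)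
  also have "\<dots> \<le> (\<Sum>i<n. e / 2 / (real n + 1))"
  proof (intro sum_mono)
    fix i assume "i \<in> {..<n}"
    then have "(\<integral>t. norm (f i t - s i t) \<partial>M) * norm (y i) \<le> d i * (norm (y i) + 1)"
      using sd[of i] d[of i] by (intro mult_mono) auto
    also have "\<dots> = e / 2 / (real n + 1)"
      using norm_ge_zero[of "y i"] by (simp add: d_def field_simps add_nonneg_eq_0_iff)
    finally show "(\<integral>t. norm (f i t - s i t) \<partial>M) * norm (y i) \<le> e / 2 / (real n + 1)" .
  qed
  also have "\<dots> \<le> e / 2" using e by (simp add: field_simps)
  finally have cE: "cost E \<le> e / 2" .
  have "AE t in M. tfun S t = tfun (w + tscale (-1) E) t"
    using tc_tfun[OF tcw] tfun_tscale[OF wf(1), of "-1"] by eventually_elim simp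
  then have "tnorm S = tnorm (w + tscale (-1) E)"
    using w wf by (intro tnorm_cong) auto
  also have "\<dots> \<le> tnorm w + tnorm E"
    using tnorm_triangle[of w "tscale (-1) E"] tnorm_tscale[OF wf(1), of "-1"] w wf by simp
  finally have "tnorm S \<le> tnorm w + cost E"
    using integral_norm_tfun_le[OF wf(1)] by (simp add: tnorm_def)
  moreover have "tnorm v = tnorm S"
    using tc_tfun[OF v(1)] tc_wf[OF v(1)] by (intro tnorm_cong) auto
  moreover have "tc (E + S) (E + v)" using v(1) wf by (intro tc_plus tc_refl')
  ultimately show ?thesis
    using tcw cE v(2) by (intro exI[of _ "E + v"]) (auto intro: tc_trans)
qed

text \<open>The bound of \<open>tfun_bound\<close> is the same for all members of a class, because
  congruent representations have almost everywhere equal functions; \<open>cost_approx\<close> shows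
  that it is the infimum.\<close>

lemma vnorm_alg_tensor:
  assumes "wf_rep w"
  shows "vnorm (alg_tensor (L1 M) (nspace_of sc)) (tclass w) = tnorm w"
proof -
  have lower: "tnorm w \<le> cost v" if "v \<in> tclass w" for v
  proof -
    have "tc w v" using that by (simp add: tensor_class_def)
    then have "tnorm w = tnorm v" using tc_tfun tc_wf by (intro tnorm_cong) auto
    then show ?thesis
      using integral_norm_tfun_le[of v] tc_wf[OF \<open>tc w v\<close>] by (simp add: tnorm_def)
  qed
  have "(INF v\<in>tclass w. cost v) = tnorm w"
  proof (rule antisym)
    show "(INF v\<in>tclass w. cost v) \<le> tnorm w"
    proof (rule field_le_epsilon)
      fix e :: real assume "0 < e"
      then obtain v where "tc w v" "cost v \<le> tnorm w + e" using cost_approx[OF assms] by blast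
      then show "(INF v\<in>tclass w. cost v) \<le> tnorm w + e"
        using lower by (intro cINF_lower2[of _ _ v] bdd_belowI2[of _ "tnorm w"]) (auto simp: tensor_class_def)
    qed
    have "w \<in> tclass w" using assms by (simp add: tensor_class_def tc_refl')
    then show "tnorm w \<le> (INF v\<in>tclass w. cost v)"
      using lower by (intro cINF_greatest) auto
  qed
  then show ?thesis by (simp add: alg_tensor_def)
qed

end

section \<open>Completions\<close>

text \<open>The records carry no algebraic laws, so the assumptions are phrased through the
  distance, which is all that Cauchy classes see. A seminorm is enough, since a Cauchy class
  identifies sequences whose distance tends to 0.\<close>

locale seminormed_nspace =
  fixes N :: "('k::real_normed_field, 'v) nspace"
  assumes vadd_closed: "\<And>u v. \<lbrakk>u \<in> vcarrier N; v \<in> vcarrier N\<rbrakk> \<Longrightarrow> vadd N u v \<in> vcarrier N"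
    and vscale_closed: "\<And>c u. u \<in> vcarrier N \<Longrightarrow> vscale N c u \<in> vcarrier N"
    and dist_self: "\<And>u. u \<in> vcarrier N \<Longrightarrow> vnorm N (vminus N u u) = 0"
    and dist_nonneg: "\<And>u v. \<lbrakk>u \<in> vcarrier N; v \<in> vcarrier N\<rbrakk> \<Longrightarrow> 0 \<le> vnorm N (vminus N u v)"
    and dist_commute: "\<And>u v. \<lbrakk>u \<in> vcarrier N; v \<in> vcarrier N\<rbrakk> \<Longrightarrow>
      vnorm N (vminus N u v) = vnorm N (vminus N v u)"
    and dist_triangle: "\<And>u v w. \<lbrakk>u \<in> vcarrier N; v \<in> vcarrier N; w \<in> vcarrier N\<rbrakk> \<Longrightarrow>
      vnorm N (vminus N u w) \<le> vnorm N (vminus N u v) + vnorm N (vminus N v w)"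
    and dist_vadd: "\<And>u u' v v'.
      \<lbrakk>u \<in> vcarrier N; u' \<in> vcarrier N; v \<in> vcarrier N; v' \<in> vcarrier N\<rbrakk> \<Longrightarrow>
      vnorm N (vminus N (vadd N u v) (vadd N u' v')) \<le> vnorm N (vminus N u u') + vnorm N (vminus N v v')"
    and dist_vscale: "\<And>c u v. \<lbrakk>u \<in> vcarrier N; v \<in> vcarrier N\<rbrakk> \<Longrightarrow>
      vnorm N (vminus N (vscale N c u) (vscale N c v)) = norm c * vnorm N (vminus N u v)"
    and norm_le_dist: "\<And>u v. \<lbrakk>u \<in> vcarrier N; v \<in> vcarrier N\<rbrakk> \<Longrightarrow>
      vnorm N u \<le> vnorm N v + vnorm N (vminus N u v)"
begin

abbreviation vdist where "vdist u v \<equiv> vnorm N (vminus N u v)"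

lemma vcauchy_in: "vcauchy N s \<Longrightarrow> s n \<in> vcarrier N"
  by (simp add: vcauchy_def)

lemma vcauchy_const: "u \<in> vcarrier N \<Longrightarrow> vcauchy N (\<lambda>_. u)"
  by (simp add: vcauchy_def dist_self)

lemma vcauchy_vadd:
  assumes s: "vcauchy N s" and t: "vcauchy N t"
  shows "vcauchy N (\<lambda>n. vadd N (s n) (t n))"
  unfolding vcauchy_def
proof (intro conjI allI impI)
  show "vadd N (s n) (t n) \<in> vcarrier N" for n
    by (intro vadd_closed vcauchy_in s t)
  fix e :: real assume "0 < e"
  then have "0 < e / 2" by simp
  obtain n1 where n1: "\<And>m n. m \<ge> n1 \<Longrightarrow> n \<ge> n1 \<Longrightarrow> vdist (s m) (s n) < e / 2"
    using s \<open>0 < e / 2\<close> unfolding vcauchy_def by metis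
  obtain n2 where n2: "\<And>m n. m \<ge> n2 \<Longrightarrow> n \<ge> n2 \<Longrightarrow> vdist (t m) (t n) < e / 2"
    using t \<open>0 < e / 2\<close> unfolding vcauchy_def by metis
  have "vdist (vadd N (s m) (t m)) (vadd N (s n) (t n)) < e" if "m \<ge> max n1 n2" "n \<ge> max n1 n2" for m n
    using dist_vadd[of "s m" "s n" "t m" "t n"] n1[of m n] n2[of m n] that
    by (simp add: vcauchy_in s t)
  then show "\<exists>n0. \<forall>m\<ge>n0. \<forall>n\<ge>n0. vdist (vadd N (s m) (t m)) (vadd N (s n) (t n)) < e"
    by blast
qed

lemma vcauchy_vscale:
  assumes s: "vcauchy N s"
  shows "vcauchy N (\<lambda>n. vscale N c (s n))"
  unfolding vcauchy_def
proof (intro conjI allI impI)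
  show "vscale N c (s n) \<in> vcarrier N" for n
    by (intro vscale_closed vcauchy_in s)
  fix e :: real assume "0 < e"
  then have e: "0 < e / (norm c + 1)" by (intro divide_pos_pos) (auto simp: add_nonneg_pos)
  obtain n1 where n1: "\<And>m n. m \<ge> n1 \<Longrightarrow> n \<ge> n1 \<Longrightarrow> vdist (s m) (s n) < e / (norm c + 1)"
    using s e unfolding vcauchy_def by metis
  have "vdist (vscale N c (s m)) (vscale N c (s n)) < e" if "m \<ge> n1" "n \<ge> n1" for m n
  proof -
    have "norm c * vdist (s m) (s n) \<le> (norm c + 1) * vdist (s m) (s n)"
      by (intro mult_right_mono dist_nonneg vcauchy_in s) simp
    also have "\<dots> < (norm c + 1) * (e / (norm c + 1))"
      by (intro mult_strict_left_mono n1 that) (simp add: add_nonneg_pos)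
    also have "\<dots> = e" by (simp add: add_nonneg_eq_0_iff)
    finally show ?thesis by (simp add: dist_vscale vcauchy_in s)
  qed
  then show "\<exists>n0. \<forall>m\<ge>n0. \<forall>n\<ge>n0. vdist (vscale N c (s m)) (vscale N c (s n)) < e"
    by blast
qed

lemma cauchy_class_self: "vcauchy N s \<Longrightarrow> s \<in> cauchy_class N s"
  by (simp add: cauchy_class_def dist_self vcauchy_in)

lemma cauchy_class_eq:
  assumes s: "vcauchy N s" and t: "vcauchy N t" and st: "(\<lambda>n. vdist (s n) (t n)) \<longlonglongrightarrow> 0"
  shows "cauchy_class N s = cauchy_class N t"
proof -
  have sub: "cauchy_class N s \<subseteq> cauchy_class N t"
    if s: "vcauchy N s" and t: "vcauchy N t" and st: "(\<lambda>n. vdist (s n) (t n)) \<longlonglongrightarrow> 0" for s t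
  proof
    fix r assume "r \<in> cauchy_class N s"
    then have r: "vcauchy N r" and lim: "(\<lambda>n. vdist (s n) (r n)) \<longlonglongrightarrow> 0"
      by (auto simp: cauchy_class_def)
    have "(\<lambda>n. vdist (t n) (r n)) \<longlonglongrightarrow> 0"
    proof (rule tendsto_sandwich[OF _ _ tendsto_const])
      show "\<forall>\<^sub>F n in sequentially. 0 \<le> vdist (t n) (r n)"
        by (intro always_eventually allI dist_nonneg vcauchy_in r t)
      show "\<forall>\<^sub>F n in sequentially. vdist (t n) (r n) \<le> vdist (s n) (t n) + vdist (s n) (r n)"
        using dist_triangle[of "t _" "s _" "r _"] dist_commute[of "t _" "s _"]
        by (intro always_eventually allI) (simp add: vcauchy_in r s t)
      show "(\<lambda>n. vdist (s n) (t n) + vdist (s n) (r n)) \<longlonglongrightarrow> 0"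
        using tendsto_add[OF st lim] by simp
    qed
    then show "r \<in> cauchy_class N t" using r by (simp add: cauchy_class_def)
  qed
  have "(\<lambda>n. vdist (t n) (s n)) \<longlonglongrightarrow> 0"
    using st dist_commute[of "t _" "s _"] by (simp add: vcauchy_in s t)
  then show ?thesis using sub[OF s t st] sub[OF t s] by blast
qed

text \<open>All choices of representatives have sums at distance tending to 0, so the union in
  \<open>vcompletion\<close> is a union of equal classes.\<close>

lemma vadd_vcompletion:
  assumes s: "vcauchy N s" and t: "vcauchy N t"
  shows "vadd (vcompletion N) (cauchy_class N s) (cauchy_class N t) =
    cauchy_class N (\<lambda>n. vadd N (s n) (t n))"
proof -
  have "cauchy_class N (\<lambda>n. vadd N (s' n) (t' n)) = cauchy_class N (\<lambda>n. vadd N (s n) (t n))"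
    if "s' \<in> cauchy_class N s" "t' \<in> cauchy_class N t" for s' t'
  proof -
    have s': "vcauchy N s'" "(\<lambda>n. vdist (s n) (s' n)) \<longlonglongrightarrow> 0"
      and t': "vcauchy N t'" "(\<lambda>n. vdist (t n) (t' n)) \<longlonglongrightarrow> 0"
      using that by (auto simp: cauchy_class_def)
    have "(\<lambda>n. vdist (vadd N (s n) (t n)) (vadd N (s' n) (t' n))) \<longlonglongrightarrow> 0"
    proof (rule tendsto_sandwich[OF _ _ tendsto_const])
      show "\<forall>\<^sub>F n in sequentially. 0 \<le> vdist (vadd N (s n) (t n)) (vadd N (s' n) (t' n))"
        by (intro always_eventually allI dist_nonneg vadd_closed vcauchy_in s t s' t')
      show "\<forall>\<^sub>F n in sequentially. vdist (vadd N (s n) (t n)) (vadd N (s' n) (t' n)) \<le>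
          vdist (s n) (s' n) + vdist (t n) (t' n)"
        by (intro always_eventually allI dist_vadd vcauchy_in s t s' t')
      show "(\<lambda>n. vdist (s n) (s' n) + vdist (t n) (t' n)) \<longlonglongrightarrow> 0"
        using tendsto_add[OF s'(2) t'(2)] by simp
    qed
    then show ?thesis
      by (intro cauchy_class_eq[symmetric] vcauchy_vadd s t s' t')
  qed
  then have "(\<Union>s'\<in>cauchy_class N s. \<Union>t'\<in>cauchy_class N t. cauchy_class N (\<lambda>n. vadd N (s' n) (t' n))) =
      cauchy_class N (\<lambda>n. vadd N (s n) (t n))"
    using cauchy_class_self[OF s] cauchy_class_self[OF t] by blast
  then show ?thesis by (simp add: vcompletion_def)
qed

lemma vscale_vcompletion:
  assumes s: "vcauchy N s"
  shows "vscale (vcompletion N) c (cauchy_class N s) = cauchy_class N (\<lambda>n. vscale N c (s n))"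
proof -
  have "cauchy_class N (\<lambda>n. vscale N c (s' n)) = cauchy_class N (\<lambda>n. vscale N c (s n))"
    if "s' \<in> cauchy_class N s" for s'
  proof -
    have s': "vcauchy N s'" "(\<lambda>n. vdist (s n) (s' n)) \<longlonglongrightarrow> 0"
      using that by (auto simp: cauchy_class_def)
    have "(\<lambda>n. norm c * vdist (s n) (s' n)) \<longlonglongrightarrow> 0"
      by (rule tendsto_mult_right_zero[OF s'(2)])
    then have "(\<lambda>n. vdist (vscale N c (s n)) (vscale N c (s' n))) \<longlonglongrightarrow> 0"
      by (simp add: dist_vscale vcauchy_in s s')
    then show ?thesis
      by (intro cauchy_class_eq[symmetric] vcauchy_vscale s s')
  qed
  then have "(\<Union>s'\<in>cauchy_class N s. cauchy_class N (\<lambda>n. vscale N c (s' n))) =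
      cauchy_class N (\<lambda>n. vscale N c (s n))"
    using cauchy_class_self[OF s] by blast
  then show ?thesis by (simp add: vcompletion_def)
qed

lemma vminus_vcompletion:
  assumes s: "vcauchy N s" and t: "vcauchy N t"
  shows "vminus (vcompletion N) (cauchy_class N s) (cauchy_class N t) =
    cauchy_class N (\<lambda>n. vminus N (s n) (t n))"
  by (simp add: vminus_def vadd_vcompletion vscale_vcompletion vcauchy_vscale s t)

lemma vcauchy_vminus:
  assumes s: "vcauchy N s" and t: "vcauchy N t"
  shows "vcauchy N (\<lambda>n. vminus N (s n) (t n))"
  by (simp add: vminus_def vcauchy_vadd vcauchy_vscale s t)

lemma abs_norm_diff_le:
  assumes "u \<in> vcarrier N" "v \<in> vcarrier N"
  shows "\<bar>vnorm N u - vnorm N v\<bar> \<le> vdist u v"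
  using norm_le_dist[OF assms] norm_le_dist[OF assms(2,1)] dist_commute[OF assms] by simp

lemma vcauchy_norm_convergent:
  assumes s: "vcauchy N s"
  shows "convergent (\<lambda>n. vnorm N (s n))"
proof (intro Cauchy_convergent CauchyI)
  fix e :: real assume "0 < e"
  then obtain n0 where "\<And>m n. m \<ge> n0 \<Longrightarrow> n \<ge> n0 \<Longrightarrow> vdist (s m) (s n) < e"
    using s unfolding vcauchy_def by metis
  then show "\<exists>n0. \<forall>m\<ge>n0. \<forall>n\<ge>n0. norm (vnorm N (s m) - vnorm N (s n)) < e"
    using abs_norm_diff_le[OF vcauchy_in[OF s] vcauchy_in[OF s]] by (metis order.strict_trans1 real_norm_def)
qed

text \<open>Equivalent Cauchy sequences have the same limit of norms, which resolves the definite
  description in \<open>vcompletion\<close>.\<close>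

lemma vnorm_vcompletion:
  assumes s: "vcauchy N s" and lim: "(\<lambda>n. vnorm N (s n)) \<longlonglongrightarrow> r"
  shows "vnorm (vcompletion N) (cauchy_class N s) = r"
proof -
  have "(\<lambda>n. vnorm N (s' n)) \<longlonglongrightarrow> r" if "s' \<in> cauchy_class N s" for s'
  proof -
    have s': "vcauchy N s'" "(\<lambda>n. vdist (s n) (s' n)) \<longlonglongrightarrow> 0"
      using that by (auto simp: cauchy_class_def)
    have "(\<lambda>n. vnorm N (s n) - vnorm N (s' n)) \<longlonglongrightarrow> 0"
      by (rule Lim_null_comparison[OF _ s'(2)])
        (auto intro!: always_eventually abs_norm_diff_le vcauchy_in s s')
    from tendsto_diff[OF lim this] show ?thesis by simp
  qed
  then have "(THE r. \<exists>s'\<in>cauchy_class N s. (\<lambda>n. vnorm N (s' n)) \<longlonglongrightarrow> r) = r"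
    using cauchy_class_self[OF s] by (intro the_equality) (auto intro: LIMSEQ_unique)
  then show ?thesis by (simp add: vcompletion_def)
qed

end

section \<open>The algebraic tensor product as a seminormed space\<close>

context L1_tensor
begin

abbreviation alg where "alg \<equiv> alg_tensor (L1 M) (nspace_of sc)"

definition tdist where "tdist v w = tnorm (v + tscale (-1) w)"

lemma tclass_self: "wf_rep w \<Longrightarrow> w \<in> tclass w"
  by (simp add: tensor_class_def tc_refl')

lemma alg_carrier: "vcarrier alg = tclass ` {w. wf_rep w}"
  by (simp add: alg_tensor_def wf_rep_iff)

lemma vadd_alg:
  assumes "wf_rep v" "wf_rep w"
  shows "vadd alg (tclass v) (tclass w) = tclass (v + w)"
proof -
  have "tclass (v' + w') = tclass (v + w)" if "v' \<in> tclass v" "w' \<in> tclass w" for v' w'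
    using that by (intro tensor_class_eq[symmetric] tc_plus) (auto simp: tensor_class_def)
  then have "(\<Union>v'\<in>tclass v. \<Union>w'\<in>tclass w. tclass (v' + w')) = tclass (v + w)"
    using tclass_self[OF assms(1)] tclass_self[OF assms(2)] by blast
  then show ?thesis by (simp add: alg_tensor_def)
qed

lemma vscale_alg:
  assumes "wf_rep w"
  shows "vscale alg c (tclass w) = tclass (tscale c w)"
proof -
  have "tclass (tscale c w') = tclass (tscale c w)" if "w' \<in> tclass w" for w'
    using that by (intro tensor_class_eq[symmetric] tc_tscale) (auto simp: tensor_class_def)
  then have "(\<Union>w'\<in>tclass w. tclass (tscale c w')) = tclass (tscale c w)"
    using tclass_self[OF assms] by blast
  then show ?thesis by (simp add: alg_tensor_def tscale_def)
qed

lemma vdist_alg: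
  assumes "wf_rep v" "wf_rep w"
  shows "vnorm alg (vminus alg (tclass v) (tclass w)) = tdist v w"
  using assms by (simp add: vminus_def vscale_alg vadd_alg vnorm_alg_tensor tdist_def)

text \<open>Reduces statements about distances to pointwise ones about norms in \<open>'y\<close>.
  Scaling by -1 negates \<open>tfun\<close> only almost everywhere, so the measurability of the
  difference is derived anew from simple approximations.\<close>

lemma tdist_integral:
  assumes "wf_rep v" "wf_rep w"
  shows "integrable M (\<lambda>t. norm (tfun v t - tfun w t))"
    and "tdist v w = (\<integral>t. norm (tfun v t - tfun w t) \<partial>M)"
proof -
  have wf: "wf_rep (v + tscale (-1) w)" using assms by simp
  have AE: "AE t in M. norm (tfun (v + tscale (-1) w) t) = norm (tfun v t - tfun w t)"
    using tfun_tscale[OF assms(2), of "-1"] by eventually_elim simp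
  obtain s where s: "\<And>i. simple_function M (s i)" "\<And>t. t \<in> space M \<Longrightarrow> (\<lambda>i. s i t) \<longlonglongrightarrow> tfun v t"
    using tfun_approx_simple[OF assms(1)] by auto
  obtain r where r: "\<And>i. simple_function M (r i)" "\<And>t. t \<in> space M \<Longrightarrow> (\<lambda>i. r i t) \<longlonglongrightarrow> tfun w t"
    using tfun_approx_simple[OF assms(2)] by auto
  have "(\<lambda>t. norm (s i t - r i t)) \<in> borel_measurable M" for i
    by (intro borel_measurable_simple_function simple_function_compose2[OF s(1) r(1)])
  then have meas: "(\<lambda>t. norm (tfun v t - tfun w t)) \<in> borel_measurable M"
    by (rule borel_measurable_LIMSEQ_metric[where f="\<lambda>i t. norm (s i t - r i t)"])
      (intro tendsto_norm tendsto_diff s(2) r(2))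
  show "integrable M (\<lambda>t. norm (tfun v t - tfun w t))"
    by (rule integrable_cong_AE_imp[OF integrable_norm_tfun[OF wf] meas AE])
  show "tdist v w = (\<integral>t. norm (tfun v t - tfun w t) \<partial>M)"
    unfolding tdist_def tnorm_def
    by (rule integral_cong_AE[OF norm_tfun_measurable[OF wf] meas AE])
qed

text \<open>The common shape of the triangle inequality, of the estimate for sums and of the
  comparison between norm and distance in \<open>seminormed_nspace\<close>.\<close>

lemma tdist_mono_sum:
  assumes "wf_rep u" "wf_rep v" "wf_rep u'" "wf_rep v'" "wf_rep u''" "wf_rep v''"
    and le: "AE t in M. norm (tfun u t - tfun v t) \<le>
      norm (tfun u' t - tfun v' t) + norm (tfun u'' t - tfun v'' t)"
  shows "tdist u v \<le> tdist u' v' + tdist u'' v''"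
  unfolding tdist_integral(2)[OF assms(1,2)] tdist_integral(2)[OF assms(3,4)]
    tdist_integral(2)[OF assms(5,6)]
  by (subst Bochner_Integration.integral_add[symmetric])
    (intro tdist_integral assms integral_mono_AE Bochner_Integration.integrable_add)+

sublocale alg: seminormed_nspace alg
proof
  fix u v assume "u \<in> vcarrier alg" "v \<in> vcarrier alg"
  then show "vadd alg u v \<in> vcarrier alg" by (auto simp: alg_carrier vadd_alg)
next
  fix c u assume "u \<in> vcarrier alg"
  then show "vscale alg c u \<in> vcarrier alg" by (auto simp: alg_carrier vscale_alg)
next
  fix u assume "u \<in> vcarrier alg"
  then show "vnorm alg (vminus alg u u) = 0"
    by (auto simp: alg_carrier vdist_alg tdist_integral)
next
  fix u v assume "u \<in> vcarrier alg" "v \<in> vcarrier alg"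
  then show "0 \<le> vnorm alg (vminus alg u v)"
    by (auto simp: alg_carrier vdist_alg tdist_integral)
next
  fix u v assume "u \<in> vcarrier alg" "v \<in> vcarrier alg"
  then show "vnorm alg (vminus alg u v) = vnorm alg (vminus alg v u)"
    by (auto simp: alg_carrier vdist_alg tdist_integral norm_minus_commute)
next
  fix u v w assume "u \<in> vcarrier alg" "v \<in> vcarrier alg" "w \<in> vcarrier alg"
  then obtain u' v' w' where wf: "wf_rep u'" "wf_rep v'" "wf_rep w'"
    and eq: "u = tclass u'" "v = tclass v'" "w = tclass w'" by (auto simp: alg_carrier)
  have "tdist u' w' \<le> tdist u' v' + tdist v' w'"
    by (intro tdist_mono_sum wf AE_I2) (metis dist_triangle dist_norm)
  then show "vnorm alg (vminus alg u w) \<le> vnorm alg (vminus alg u v) + vnorm alg (vminus alg v w)"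
    by (simp add: eq vdist_alg wf)
next
  fix u u' v v'
  assume "u \<in> vcarrier alg" "u' \<in> vcarrier alg" "v \<in> vcarrier alg" "v' \<in> vcarrier alg"
  then obtain a a' b b' where wf: "wf_rep a" "wf_rep a'" "wf_rep b" "wf_rep b'"
    and eq: "u = tclass a" "u' = tclass a'" "v = tclass b" "v' = tclass b'" by (auto simp: alg_carrier)
  have "tdist (a + b) (a' + b') \<le> tdist a a' + tdist b b'"
    by (intro tdist_mono_sum AE_I2) (auto simp: wf norm_diff_triangle_ineq)
  then show "vnorm alg (vminus alg (vadd alg u v) (vadd alg u' v')) \<le>
      vnorm alg (vminus alg u u') + vnorm alg (vminus alg v v')"
    by (simp add: eq vdist_alg vadd_alg wf)
next
  fix c u v assume "u \<in> vcarrier alg" "v \<in> vcarrier alg"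
  then obtain a b where wf: "wf_rep a" "wf_rep b" and eq: "u = tclass a" "v = tclass b"
    by (auto simp: alg_carrier)
  \<comment> \<open>The two multisets differ, but they stand for the same function almost
    everywhere, and \<open>tnorm\<close> only depends on that function.\<close>
  have "AE t in M. tfun (tscale c a + tscale (-1) (tscale c b)) t = tfun (tscale c (a + tscale (-1) b)) t"
    using tfun_tscale[OF wf(2), of c] tfun_tscale[OF wf(2), of "-1"] tfun_tscale[OF wf(1), of c]
      tfun_tscale[OF wf_rep_tscale[OF wf(2)], of "-1" c] tfun_tscale[OF wf_rep_tscale[OF wf(2)], of c "-1"]
    by eventually_elim simp
  then have "tdist (tscale c a) (tscale c b) = tnorm (tscale c (a + tscale (-1) b))"
    unfolding tdist_def using wf by (intro tnorm_cong) auto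
  also have "\<dots> = norm c * tdist a b"
    unfolding tdist_def using wf by (intro tnorm_tscale) auto
  finally show "vnorm alg (vminus alg (vscale alg c u) (vscale alg c v)) = norm c * vnorm alg (vminus alg u v)"
    by (simp add: eq vdist_alg vscale_alg wf)
next
  fix u v assume "u \<in> vcarrier alg" "v \<in> vcarrier alg"
  then obtain a b where wf: "wf_rep a" "wf_rep b" and eq: "u = tclass a" "v = tclass b"
    by (auto simp: alg_carrier)
  \<comment> \<open>The empty multiset is the zero tensor, so the distance to it is the
    norm.\<close>
  have "tdist a {#} \<le> tdist b {#} + tdist a b"
    using wf by (intro tdist_mono_sum AE_I2) (auto simp: norm_triangle_sub)
  then show "vnorm alg u \<le> vnorm alg v + vnorm alg (vminus alg u v)"
    by (simp add: eq vdist_alg vnorm_alg_tensor wf tdist_def)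
qed

section \<open>Norm attainment in terms of representatives\<close>

abbreviation tsum :: "(nat \<Rightarrow> 'a \<Rightarrow> 'k) \<Rightarrow> (nat \<Rightarrow> 'y) \<Rightarrow> nat \<Rightarrow> _" where "tsum f y n \<equiv> (\<Sum>i\<le>n. {#(cls (f i), y i)#})"

lemma wf_tsum: "(\<And>i. integrable M (f i)) \<Longrightarrow> wf_rep (tsum f y n)"
  by (simp add: wf_rep_sum L1_class_in_carrier)

text \<open>Partial sums stay in the algebraic tensor product, as constant sequences. The index
  \<open>n\<close> is included in \<open>tsum\<close> because \<open>vpartial_sum\<close> at 0 is
  already the first term.\<close>

lemma vpartial_sum_elem_tensor:
  assumes f: "\<And>i. integrable M (f i)"
  shows "vpartial_sum (proj_tensor (L1 M) (nspace_of sc))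
      (\<lambda>i. elem_tensor (L1 M) (nspace_of sc) (cls (f i)) (y i)) n =
    cauchy_class alg (\<lambda>_. tclass (tsum f y n))"
proof (induction n)
  case 0
  show ?case by (simp add: elem_tensor_def)
next
  case (Suc n)
  have wf: "wf_rep {#(cls (f (Suc n)), y (Suc n))#}" "wf_rep (tsum f y n)"
    using f by (auto simp: L1_class_in_carrier wf_tsum)
  have c: "vcauchy alg (\<lambda>_. tclass w)" if "wf_rep w" for w
    using that by (intro alg.vcauchy_const) (auto simp: alg_carrier)
  show ?case
    unfolding vpartial_sum.simps Suc
    unfolding elem_tensor_def proj_tensor_def alg.vadd_vcompletion[OF c[OF wf(2)] c[OF wf(1)]] vadd_alg[OF wf(2,1)]
    by simp
qed

lemma proj_carrier_rep:
  assumes "u \<in> vcarrier (proj_tensor (L1 M) (nspace_of sc))"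
  obtains w where "\<And>n. wf_rep (w n)" "vcauchy alg (\<lambda>n. tclass (w n))"
    "u = cauchy_class alg (\<lambda>n. tclass (w n))"
proof -
  obtain s where s: "vcauchy alg s" "u = cauchy_class alg s"
    using assms by (auto simp: proj_tensor_def vcompletion_def)
  have "\<exists>w. wf_rep w \<and> s n = tclass w" for n
    using alg.vcauchy_in[OF s(1), of n] by (auto simp: alg_carrier)
  then obtain w where "\<And>n. wf_rep (w n)" "\<And>n. s n = tclass (w n)" by metis
  moreover from this(2) have "s = (\<lambda>n. tclass (w n))" by blast
  ultimately show ?thesis using that s by blast
qed

lemma vcauchy_alg_iff:
  assumes "\<And>n. wf_rep (w n)"
  shows "vcauchy alg (\<lambda>n. tclass (w n)) \<longleftrightarrow> (\<forall>e>0. \<exists>n0. \<forall>m\<ge>n0. \<forall>n\<ge>n0. tdist (w m) (w n) < e)"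
  using assms by (simp add: vcauchy_def alg_carrier vdist_alg)

text \<open>The distance of a partial sum to an element of the completion is itself a limit along
  \<open>w\<close>; the number \<open>d n\<close> is that limit for the \<open>n\<close>-th partial
  sum. Uniqueness of limits makes the existential over \<open>d\<close> harmless.\<close>

lemma attains_proj_norm_iff:
  assumes w: "\<And>n. wf_rep (w n)" and c: "vcauchy alg (\<lambda>n. tclass (w n))"
    and r: "(\<lambda>n. tnorm (w n)) \<longlonglongrightarrow> r"
  shows "attains_proj_norm (L1 M) (nspace_of sc) (cauchy_class alg (\<lambda>n. tclass (w n))) \<longleftrightarrow>
    (\<exists>f y. (\<forall>i. integrable M (f i)) \<and>
      (\<exists>d. (\<forall>n. (\<lambda>m. tdist (tsum f y n) (w m)) \<longlonglongrightarrow> d n) \<and> d \<longlonglongrightarrow> 0) \<and>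
      (\<lambda>i. (\<integral>t. norm (f i t) \<partial>M) * norm (y i)) sums r)" (is "?L \<longleftrightarrow> ?R")
proof -
  let ?u = "cauchy_class alg (\<lambda>n. tclass (w n))"
  let ?P = "proj_tensor (L1 M) (nspace_of sc)"
  have norm: "vnorm ?P ?u = r"
    unfolding proj_tensor_def using r w by (intro alg.vnorm_vcompletion c) (simp add: vnorm_alg_tensor)
  have ps: "(\<lambda>m. tdist (tsum f y n) (w m)) \<longlonglongrightarrow>
      vnorm ?P (vminus ?P (vpartial_sum ?P (\<lambda>i. elem_tensor (L1 M) (nspace_of sc) (cls (f i)) (y i)) n) ?u)"
    if f: "\<And>i. integrable M (f i)" for f y n
  proof -
    note wf = wf_tsum[of f y n, OF f]
    have c': "vcauchy alg (\<lambda>_. tclass (tsum f y n))"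
      using wf by (intro alg.vcauchy_const) (auto simp: alg_carrier)
    note cm = alg.vcauchy_vminus[OF c' c]
    obtain l where l: "(\<lambda>m. vnorm alg (vminus alg (tclass (tsum f y n)) (tclass (w m)))) \<longlonglongrightarrow> l"
      using alg.vcauchy_norm_convergent[OF cm] by (auto simp: convergent_def)
    show ?thesis
      unfolding vpartial_sum_elem_tensor[OF f]
      unfolding proj_tensor_def alg.vminus_vcompletion[OF c' c] alg.vnorm_vcompletion[OF cm l]
      using l by (simp only: vdist_alg[OF wf w])
  qed
  show ?thesis
  proof
    assume ?L
    then obtain x y where x: "\<And>i. x i \<in> vcarrier (L1 M)"
      and s: "vsums ?P (\<lambda>i. elem_tensor (L1 M) (nspace_of sc) (x i) (y i)) ?u"
      and n: "(\<lambda>i. vnorm (L1 M) (x i) * vnorm (nspace_of sc) (y i)) sums r"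
      unfolding attains_proj_norm_def norm by blast
    define f where "f i = L1_rep (x i)" for i
    have f: "integrable M (f i)" "x i = cls (f i)" for i
      using L1_carrier_rep[OF x] by (auto simp: f_def)
    show ?R
      using f(1) ps[of f y] s n L1_vnorm[OF f(1)] unfolding vsums_def f(2)
      by (intro exI[of _ f] exI[of _ y] conjI exI allI) auto
  next
    assume ?R
    then obtain f y d where f: "\<And>i. integrable M (f i)"
      and d: "\<And>n. (\<lambda>m. tdist (tsum f y n) (w m)) \<longlonglongrightarrow> d n" "d \<longlonglongrightarrow> 0"
      and n: "(\<lambda>i. (\<integral>t. norm (f i t) \<partial>M) * norm (y i)) sums r" by blast
    have "d = (\<lambda>n. vnorm ?P (vminus ?P (vpartial_sum ?P
        (\<lambda>i. elem_tensor (L1 M) (nspace_of sc) (cls (f i)) (y i)) n) ?u))"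
      using LIMSEQ_unique[OF d(1) ps[OF f]] by blast
    then have "vsums ?P (\<lambda>i. elem_tensor (L1 M) (nspace_of sc) (cls (f i)) (y i)) ?u"
      using d(2) by (simp add: vsums_def)
    then show ?L
      unfolding attains_proj_norm_def norm using f n
      by (intro exI[of _ "\<lambda>i. cls (f i)"] exI[of _ y]) (auto simp: L1_class_in_carrier L1_vnorm)
  qed
qed

end

section \<open>Atoms\<close>

text \<open>Choose a countable family whose union has the largest possible measure. A further
  admissible set outside the union could be added to the family, so it must be null; finiteness of
  the measure of \<open>E\<close> permits the cancellation. It serves below both for atoms and for
  sets of small measure.\<close>

lemma exhaustion:
  fixes M :: "'a measure"
  assumes E: "E \<in> sets M" "emeasure M E < \<infinity>"
  obtains \<C> where "countable \<C>" "\<And>A. A \<in> \<C> \<Longrightarrow> A \<in> sets M \<and> A \<subseteq> E \<and> P A"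
    "\<And>B. \<lbrakk>B \<in> sets M; B \<subseteq> E - \<Union>\<C>; P B\<rbrakk> \<Longrightarrow> emeasure M B = 0"
proof -
  define G where "G = {\<C>. countable \<C> \<and> (\<forall>A\<in>\<C>. A \<in> sets M \<and> A \<subseteq> E \<and> P A)}"
  let ?g = "\<lambda>\<C>. emeasure M (\<Union>\<C>)"
  have "{} \<in> G" by (simp add: G_def)
  then obtain f :: "nat \<Rightarrow> ennreal" where f: "range f \<subseteq> ?g ` G" "Sup (?g ` G) = Sup (range f)"
    using ennreal_SUP_countable_SUP[of G ?g] by blast
  have "\<forall>n. \<exists>\<C>. \<C> \<in> G \<and> f n = ?g \<C>" using f(1) by blast
  then obtain C where C: "\<And>n. C n \<in> G" "\<And>n. f n = ?g (C n)" by metis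
  \<comment> \<open>The values \<open>f n\<close> have the supremum as their least upper bound, and
    the union of \<open>D\<close> contains every union of \<open>C n\<close>, so it attains the
    supremum.\<close>
  define D where "D = (\<Union>n. C n)"
  have D: "D \<in> G" using C(1) by (auto simp: D_def G_def)
  have sets: "\<Union>\<C> \<in> sets M" if "\<C> \<in> G" for \<C>
    using that by (auto simp: G_def)
  have "f n \<le> ?g D" for n
    unfolding C(2) using sets[OF D] by (intro emeasure_mono) (auto simp: D_def)
  then have sup: "Sup (?g ` G) \<le> ?g D" unfolding f(2) by (intro SUP_least) auto
  show ?thesis
  proof (rule that)
    show "countable D" "\<And>A. A \<in> D \<Longrightarrow> A \<in> sets M \<and> A \<subseteq> E \<and> P A"
      using D by (auto simp: G_def)
    fix B assume B: "B \<in> sets M" "B \<subseteq> E - \<Union>D" "P B"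
    then have "insert B D \<in> G" using D by (auto simp: G_def)
    then have "?g (insert B D) \<le> ?g D" using sup by (meson SUP_upper order_trans)
    moreover have "?g (insert B D) = ?g D + emeasure M B"
      using B sets[OF D] by (subst plus_emeasure) (auto simp: Un_commute)
    moreover have "?g D \<le> emeasure M E"
      using D E by (intro emeasure_mono) (auto simp: G_def)
    then have "?g D < \<infinity>" using E(2) by (rule order.strict_trans1)
    ultimately show "emeasure M B = 0"
      by (metis add.right_neutral antisym ennreal_add_left_cancel infinity_ennreal_def order_less_irrefl zero_le add_increasing2 order_refl)
  qed
qed

text \<open>Remove a maximal countable family of atoms from a set that fails to be purely atomic. If
  the rest were null, the family would witness pure atomicity, including its completeness clause: an
  atom essentially different from all members meets each in a null set and would be null
  itself.\<close>

lemma not_purely_atomic_atomless: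
  assumes "\<not> purely_atomic M"
  obtains R where "R \<in> sets M" "0 < emeasure M R" "emeasure M R < \<infinity>"
    "\<And>B. B \<subseteq> R \<Longrightarrow> \<not> atom M B"
proof -
  obtain E where E: "E \<in> sets M" "0 < emeasure M E" "emeasure M E < \<infinity>"
    and npa: "\<not> purely_atomic_set M E"
    using assms by (auto simp: purely_atomic_def)
  obtain \<C> where \<C>: "countable \<C>" "\<And>A. A \<in> \<C> \<Longrightarrow> A \<in> sets M \<and> A \<subseteq> E \<and> atom M A"
    and max: "\<And>B. \<lbrakk>B \<in> sets M; B \<subseteq> E - \<Union>\<C>; atom M B\<rbrakk> \<Longrightarrow> emeasure M B = 0"
    using exhaustion[OF E(1,3), of "atom M"] by blast
  define R where "R = E - \<Union>\<C>"
  have R: "R \<in> sets M" using E \<C> by (auto simp: R_def)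
  have "emeasure M R \<noteq> 0"
  proof
    assume R0: "emeasure M R = 0"
    have "\<exists>A\<in>\<C>. (A - B) \<union> (B - A) \<in> null_sets M" if B: "atom M B" "B \<subseteq> E" for B
    proof (rule ccontr)
      assume neg: "\<not> ?thesis"
      \<comment> \<open>If two atoms meet in a set of positive measure, that set has full measure in
        both, so the atoms agree up to null sets.\<close>
      have "B \<inter> A \<in> null_sets M" if A: "A \<in> \<C>" for A
      proof (rule ccontr)
        assume "B \<inter> A \<notin> null_sets M"
        moreover have sets: "A \<in> sets M" "B \<in> sets M" using A B \<C>(2) by (auto simp: atom_def)
        ultimately have "emeasure M (B \<inter> A) \<noteq> 0" by auto
        then have "emeasure M (B \<inter> A) = emeasure M B" "emeasure M (B \<inter> A) = emeasure M A"
          using \<C>(2)[OF A] B(1) sets unfolding atom_def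
          by (metis inf.cobounded1 sets.Int, metis inf.cobounded2 sets.Int)
        moreover have "emeasure M A < \<infinity>" "emeasure M B < \<infinity>"
          using \<C>(2)[OF A] B(1) by (auto simp: atom_def)
        ultimately have "emeasure M (A - B \<inter> A) = 0" "emeasure M (B - B \<inter> A) = 0"
          using sets by (subst emeasure_Diff; auto)+
        moreover have "A - B \<inter> A = A - B" "B - B \<inter> A = B - A" by auto
        ultimately have "A - B \<in> null_sets M" "B - A \<in> null_sets M"
          using sets by (auto simp: null_sets_def)
        then show False using neg A by blast
      qed
      then have "(\<Union>A\<in>\<C>. B \<inter> A) \<in> null_sets M"
        using \<C>(1) by (intro null_sets_UN') auto
      moreover have "R \<in> null_sets M" using R R0 by auto
      ultimately have "(\<Union>A\<in>\<C>. B \<inter> A) \<union> R \<in> null_sets M" by auto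
      moreover have "B \<subseteq> (\<Union>A\<in>\<C>. B \<inter> A) \<union> R" using B(2) by (auto simp: R_def)
      ultimately have "emeasure M B = 0"
        using B(1) null_sets_subset[of _ M B] by (auto simp: atom_def)
      then show False using B(1) by (simp add: atom_def)
    qed
    moreover have "(E - \<Union>\<C>) \<union> (\<Union>\<C> - E) = R" using \<C>(2) by (auto simp: R_def)
    moreover have "R \<in> null_sets M" using R R0 by auto
    ultimately have "purely_atomic_set M E"
      unfolding purely_atomic_set_def using \<C> by (intro exI[of _ \<C>]) auto
    then show False using npa by simp
  qed
  moreover have "emeasure M R \<le> emeasure M E"
    using E by (intro emeasure_mono) (auto simp: R_def)
  moreover have "\<not> atom M B" if "B \<subseteq> R" for B
  proof
    assume B: "atom M B"
    then have "emeasure M B = 0" using max[of B] that by (simp add: R_def atom_def[of M B])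
    then show False using B by (simp add: atom_def)
  qed
  ultimately show ?thesis using that R E(3) by (metis order.strict_trans1 zero_less_iff_neq_zero)
qed

text \<open>A non-null set that is no atom splits into two non-null parts, and the smaller one has
  at most half the measure. Multiplying by \<open>2 ^ n\<close> avoids division of extended
  reals.\<close>

lemma atomless_halving:
  assumes R: "\<And>B. B \<subseteq> R \<Longrightarrow> \<not> atom M B"
    and S: "S \<in> sets M" "S \<subseteq> R" "0 < emeasure M S" "emeasure M S < \<infinity>"
  shows "\<exists>B\<in>sets M. B \<subseteq> S \<and> 0 < emeasure M B \<and> 2 ^ n * emeasure M B \<le> emeasure M S"
proof (induction n)
  case 0
  then show ?case using S by auto
next
  case (Suc n)
  then obtain T where T: "T \<in> sets M" "T \<subseteq> S" "0 < emeasure M T" "2 ^ n * emeasure M T \<le> emeasure M S"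
    by blast
  have "emeasure M T \<le> emeasure M S" using S T by (intro emeasure_mono)
  then have Tfin: "emeasure M T < \<infinity>" using S(4) by (rule order.strict_trans1)
  then obtain B where B: "B \<in> sets M" "B \<subseteq> T" "emeasure M B \<noteq> 0" "emeasure M B \<noteq> emeasure M T"
    using R[of T] S T unfolding atom_def by blast
  have split: "emeasure M B + emeasure M (T - B) = emeasure M T"
    using B T by (subst plus_emeasure) (auto simp: Un_absorb1)
  then have nz: "emeasure M (T - B) \<noteq> 0" using B(4) by auto
  have "\<exists>C\<in>{B, T - B}. 2 * emeasure M C \<le> emeasure M T"
  proof (cases "emeasure M B \<le> emeasure M (T - B)")
    case True
    then show ?thesis using split by (auto simp: mult_2 intro!: add_left_mono simp flip: split)
  next
    case False
    then show ?thesis using split by (auto simp: mult_2 intro!: add_right_mono simp flip: split)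
  qed
  then obtain C where C: "C \<in> {B, T - B}" "2 * emeasure M C \<le> emeasure M T" by blast
  have "2 ^ Suc n * emeasure M C = 2 ^ n * (2 * emeasure M C)" by (simp add: mult_ac)
  also have "\<dots> \<le> 2 ^ n * emeasure M T" using C(2) by (intro mult_left_mono) auto
  also have "\<dots> \<le> emeasure M S" by (rule T(4))
  finally show ?case
    using C(1) B T nz by (intro bexI[of _ C]) (auto simp: zero_less_iff_neq_zero)
qed

text \<open>Exhaust \<open>R\<close> by sets of measure at most \<open>e\<close>. A non-null
  remainder would by repeated halving contain another such set of positive measure, contradicting
  maximality.\<close>

lemma atomless_small_cover:
  assumes R: "R \<in> sets M" "emeasure M R < \<infinity>" "\<And>B. B \<subseteq> R \<Longrightarrow> \<not> atom M B" and e: "0 < (e::real)"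
  obtains \<C> where "countable \<C>" "\<And>A. A \<in> \<C> \<Longrightarrow> A \<in> sets M \<and> emeasure M A \<le> ennreal e"
    "emeasure M (R - \<Union>\<C>) = 0"
proof -
  obtain \<C> where \<C>: "countable \<C>" "\<And>A. A \<in> \<C> \<Longrightarrow> A \<in> sets M \<and> A \<subseteq> R \<and> emeasure M A \<le> ennreal e"
    and max: "\<And>B. \<lbrakk>B \<in> sets M; B \<subseteq> R - \<Union>\<C>; emeasure M B \<le> ennreal e\<rbrakk> \<Longrightarrow> emeasure M B = 0"
    using exhaustion[OF R(1,2), of "\<lambda>A. emeasure M A \<le> ennreal e"] by blast
  define S where "S = R - \<Union>\<C>"
  have S: "S \<in> sets M" using R(1) \<C> by (auto simp: S_def)
  have "emeasure M S \<le> emeasure M R" using R(1) by (intro emeasure_mono) (auto simp: S_def)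
  then have Sfin: "emeasure M S < \<infinity>" using R(2) by (rule order.strict_trans1)
  have "emeasure M S = 0"
  proof (rule ccontr)
    assume "emeasure M S \<noteq> 0"
    then have S0: "0 < emeasure M S" by (simp add: zero_less_iff_neq_zero)
    obtain n where n: "measure M S / e < 2 ^ n" using real_arch_pow[of 2] by auto
    obtain B where B: "B \<in> sets M" "B \<subseteq> S" "0 < emeasure M B" "2 ^ n * emeasure M B \<le> emeasure M S"
      using atomless_halving[where R = R, OF R(3) S _ S0 Sfin, of n] by (auto simp: S_def)
    then have "ennreal e < emeasure M B" using max[of B] by (auto simp: S_def not_le[symmetric])
    then have "2 ^ n * ennreal e \<le> 2 ^ n * emeasure M B" by (intro mult_left_mono) auto
    also have "\<dots> \<le> emeasure M S" by (rule B(4))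
    also have "\<dots> = ennreal (measure M S)" using Sfin by (intro emeasure_eq_ennreal_measure) auto
    finally have "ennreal (2 ^ n * e) \<le> ennreal (measure M S)"
      using e by (simp add: ennreal_mult ennreal_power[symmetric])
    then have "2 ^ n * e \<le> measure M S" by (simp add: ennreal_le_iff)
    then show False using n e by (simp add: field_simps)
  qed
  then show ?thesis using that[of \<C>] \<C> by (auto simp: S_def)
qed

section \<open>A function with null level sets\<close>

text \<open>At the first difference one side gains \<open>(1/3) ^ m\<close>, while all later digits
  together are worth at most half of that. In base 2 the tail could make up the whole
  difference.\<close>

lemma ternary_less:
  fixes a b :: "nat \<Rightarrow> bool"
  assumes "\<And>k. k < m \<Longrightarrow> a k = b k" "a m" "\<not> b m"
  shows "(\<Sum>k. (1/3) ^ k * of_bool (b k)) < (\<Sum>k. (1/3) ^ k * of_bool (a k) :: real)"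
proof -
  have geo: "summable (\<lambda>k. (1/3) ^ k :: real)" by (intro summable_geometric) simp
  have sm: "summable (\<lambda>k. (1/3) ^ k * of_bool (c k) :: real)" for c :: "nat \<Rightarrow> bool"
    by (rule summable_comparison_test'[OF geo, of 0]) auto
  have geo': "summable (\<lambda>k. (1/3) ^ (k + Suc m) :: real)"
    using summable_ignore_initial_segment[OF geo] .
  have "(\<Sum>k. (1/3) ^ (k + Suc m) * of_bool (b (k + Suc m)) :: real) \<le> (\<Sum>k. (1/3) ^ (k + Suc m))"
    using summable_ignore_initial_segment[OF sm] geo' by (intro suminf_le) auto
  also have "\<dots> = (\<Sum>k. (1/3) ^ Suc m * (1/3) ^ k)" by (simp add: power_add mult.commute)
  also have "\<dots> = (1/3) ^ Suc m * (\<Sum>k. (1/3) ^ k)" using geo by (rule suminf_mult)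
  \<comment> \<open>The geometric series with ratio 1/3 sums to 3/2.\<close>
  also have "\<dots> = (1/3) ^ m / 2" by (simp add: suminf_geometric)
  finally have tail: "(\<Sum>k. (1/3) ^ (k + Suc m) * of_bool (b (k + Suc m)) :: real) \<le> (1/3) ^ m / 2" .
  have "0 \<le> (\<Sum>k. (1/3) ^ (k + Suc m) * of_bool (a (k + Suc m)) :: real)"
    using summable_ignore_initial_segment[OF sm] by (intro suminf_nonneg) auto
  moreover have "(\<Sum>k<m. (1/3) ^ k * of_bool (a k) :: real) = (\<Sum>k<m. (1/3) ^ k * of_bool (b k))"
    using assms(1) by (intro sum.cong) auto
  moreover have "0 < (1/3 :: real) ^ m" by simp
  ultimately show ?thesis
    using tail assms(2,3) suminf_split_initial_segment[OF sm[of a], of "Suc m"]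
        suminf_split_initial_segment[OF sm[of b], of "Suc m"]
    unfolding sum.lessThan_Suc by (simp only: of_bool_eq mult_1_right mult_zero_right if_True if_False)
qed

lemma ternary_inject:
  fixes a b :: "nat \<Rightarrow> bool"
  assumes "(\<Sum>k. (1/3) ^ k * of_bool (a k)) = (\<Sum>k. (1/3) ^ k * of_bool (b k) :: real)"
  shows "a = b"
proof (rule ccontr)
  assume "a \<noteq> b"
  then have ex: "\<exists>m. a m \<noteq> b m" by auto
  define m where "m = (LEAST m. a m \<noteq> b m)"
  have "a m \<noteq> b m" unfolding m_def by (rule LeastI_ex[OF ex])
  moreover have "a k = b k" if "k < m" for k using not_less_Least that unfolding m_def by blast
  ultimately show False
    using ternary_less[of m a b] ternary_less[of m b a] assms by (cases "a m") auto
qed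

text \<open>Points with the same value of \<open>g\<close> lie in the same sets \<open>A k\<close>.
  So for every \<open>n\<close> a level set either misses the whole \<open>n\<close>-th cover and is
  null, or lies inside one of its members and has measure at most
  \<open>1 / (n + 1)\<close>.\<close>

lemma not_purely_atomic_null_level_sets:
  assumes "\<not> purely_atomic M"
  obtains R and g :: "'a \<Rightarrow> real" where "R \<in> sets M" "0 < emeasure M R" "emeasure M R < \<infinity>"
    "g \<in> borel_measurable M" "\<And>t. \<bar>g t\<bar> \<le> 2" "\<And>c. {t\<in>R. g t = c} \<in> null_sets M"
proof -
  obtain R where R: "R \<in> sets M" "0 < emeasure M R" "emeasure M R < \<infinity>"
    "\<And>B. B \<subseteq> R \<Longrightarrow> \<not> atom M B"
    using not_purely_atomic_atomless[OF assms] by metis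
  have "\<exists>\<C>. countable \<C> \<and> (\<forall>A\<in>\<C>. A \<in> sets M \<and> emeasure M A \<le> ennreal (1 / (real n + 1))) \<and>
      emeasure M (R - \<Union>\<C>) = 0" for n
  proof -
    have "0 < 1 / (real n + 1)" by simp
    from atomless_small_cover[OF R(1,3,4) this] show ?thesis by metis
  qed
  then obtain C where C: "\<And>n. countable (C n)"
    "\<And>n A. A \<in> C n \<Longrightarrow> A \<in> sets M \<and> emeasure M A \<le> ennreal (1 / (real n + 1))"
    "\<And>n. emeasure M (R - \<Union>(C n)) = 0" by metis
  \<comment> \<open>The empty set makes the collection nonempty, as enumeration by
    \<open>from_nat_into\<close> requires.\<close>
  define D where "D = insert {} (\<Union>n. C n)"
  have D: "countable D" "D \<noteq> {}" using C(1) by (auto simp: D_def)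
  define A where "A = from_nat_into D"
  have A: "range A = D" unfolding A_def using D by (simp add: range_from_nat_into)
  then have Asets: "A m \<in> sets M" for m
  proof -
    have "A m \<in> D" using A by blast
    then show ?thesis using C(2) by (auto simp: D_def)
  qed
  define g :: "'a \<Rightarrow> real" where "g t = (\<Sum>k. (1/3) ^ k * of_bool (t \<in> A k))" for t
  have geo: "summable (\<lambda>k. (1/3) ^ k :: real)" by (intro summable_geometric) simp
  have sm: "summable (\<lambda>k. (1/3) ^ k * of_bool (t \<in> A k) :: real)" for t
    by (rule summable_comparison_test'[OF geo, of 0]) auto
  show ?thesis
  proof (rule that[OF R(1-3)])
    have "(\<lambda>t. \<Sum>k. (1/3) ^ k * indicator (A k) t :: real) \<in> borel_measurable M"
      using Asets by (intro borel_measurable_suminf borel_measurable_times borel_measurable_indicator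
          borel_measurable_const)
    then show meas: "g \<in> borel_measurable M" by (simp add: g_def[abs_def] indicator_def)
    \<comment> \<open>The full geometric series 3/2 is a bound; boundedness will make
      \<open>g\<close> integrable on \<open>R\<close>.\<close>
    show "\<bar>g t\<bar> \<le> 2" for t
    proof -
      have "0 \<le> g t" unfolding g_def by (intro suminf_nonneg sm) simp
      moreover have "g t \<le> (\<Sum>k. (1/3) ^ k)" unfolding g_def by (intro suminf_le sm geo) simp
      ultimately show ?thesis by (simp add: suminf_geometric)
    qed
    fix c
    let ?L = "{t\<in>R. g t = c}"
    have "?L = R \<inter> (g -` {c} \<inter> space M)" using sets.sets_into_space[OF R(1)] by auto
    then have L: "?L \<in> sets M" using R(1) measurable_sets[OF meas, of "{c}"] by simp
    have "emeasure M ?L \<le> ennreal (1 / (real n + 1))" for n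
    proof (cases "?L \<subseteq> R - \<Union>(C n)")
      case True
      then have "emeasure M ?L \<le> emeasure M (R - \<Union>(C n))"
        using R(1) C(1,2) by (intro emeasure_mono sets.Diff sets.countable_Union) auto
      then show ?thesis using C(3)[of n] by simp
    next
      case False
      then obtain t B where t: "t \<in> ?L" "t \<in> B" "B \<in> C n" by blast
      then obtain m where m: "A m = B" using A by (auto simp: D_def)
      have "?L \<subseteq> B"
      proof
        fix t' assume "t' \<in> ?L"
        then have "g t' = g t" using t(1) by simp
        then have "(\<lambda>k. t' \<in> A k) = (\<lambda>k. t \<in> A k)" unfolding g_def by (rule ternary_inject)
        then show "t' \<in> B" using t(2) m by metis
      qed
      then have "emeasure M ?L \<le> emeasure M B" using C(2)[OF t(3)] by (intro emeasure_mono) auto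
      also have "\<dots> \<le> ennreal (1 / (real n + 1))" using C(2)[OF t(3)] by simp
      finally show ?thesis .
    qed
    moreover have "(\<lambda>n. ennreal (1 / (real n + 1))) \<longlonglongrightarrow> ennreal 0"
      using LIMSEQ_inverse_real_of_nat by (intro tendsto_ennrealI) (simp add: inverse_eq_divide add.commute)
    ultimately have "emeasure M ?L \<le> ennreal 0" by (intro LIMSEQ_le_const) auto
    then show "?L \<in> null_sets M" using L by (auto simp: null_sets_def)
  qed
qed

section \<open>Granules and supports of integrable functions\<close>

text \<open>Atoms and null sets together: unlike the atoms, these are closed under measurable subsets,
  so a countable family of them can be made disjoint.\<close>

definition granule :: "'a measure \<Rightarrow> 'a set \<Rightarrow> bool" where
  "granule M A \<longleftrightarrow> A \<in> sets M \<and> emeasure M A < \<infinity> \<and>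
    (\<forall>B\<in>sets M. B \<subseteq> A \<longrightarrow> emeasure M B = 0 \<or> emeasure M B = emeasure M A)"

lemma granule_atom: "atom M A \<Longrightarrow> granule M A"
  by (simp add: granule_def atom_def)

lemma granule_empty: "granule M {}"
  by (simp add: granule_def)

lemma granule_subset:
  assumes A: "granule M A" and B: "B \<in> sets M" "B \<subseteq> A"
  shows "granule M B"
proof -
  have le: "emeasure M C \<le> emeasure M B" if "C \<subseteq> B" for C
    using that B(1) by (rule emeasure_mono)
  have "emeasure M B \<le> emeasure M A" using A B by (intro emeasure_mono) (auto simp: granule_def)
  then have "emeasure M B < \<infinity>" using A by (auto simp: granule_def intro: order.strict_trans1)
  moreover have "emeasure M C = 0 \<or> emeasure M C = emeasure M B" if C: "C \<in> sets M" "C \<subseteq> B" for C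
    using A B C le[OF C(2)] unfolding granule_def by (metis le_zero_eq order_trans)
  ultimately show ?thesis using B(1) by (simp add: granule_def)
qed

text \<open>Up to a null set, each basic open set contains all values of \<open>f\<close> on
  \<open>A\<close> or none. Outside countably many exceptional null sets, any two points of
  \<open>A\<close> have values in the same basic open sets, and separation makes these values
  equal.\<close>

lemma granule_AE_const:
  fixes f :: "'a \<Rightarrow> 'b::{second_countable_topology, t2_space}"
  assumes A: "granule M A" and f: "f \<in> borel_measurable M"
  shows "\<exists>c. AE t in M. t \<in> A \<longrightarrow> f t = c"
proof (cases "emeasure M A = 0")
  case True
  then have "AE t in M. t \<notin> A" using A by (intro AE_not_in) (auto simp: granule_def)
  then show ?thesis by (auto elim: eventually_mono)
next
  case False
  obtain \<B> :: "'b set set" where \<B>: "countable \<B>" "topological_basis \<B>"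
    using ex_countable_basis by blast
  have Asets: "A \<in> sets M" using A by (simp add: granule_def)
  \<comment> \<open>On a granule, positive measure is the same as full measure.\<close>
  define full where "full U \<longleftrightarrow> emeasure M (A \<inter> (f -` U \<inter> space M)) \<noteq> 0" for U
  have "AE t in M. t \<in> A \<longrightarrow> (f t \<in> U \<longleftrightarrow> full U)" if "U \<in> \<B>" for U
  proof -
    let ?S = "A \<inter> (f -` U \<inter> space M)"
    have S: "?S \<in> sets M"
      using Asets measurable_sets[OF f] topological_basis_open[OF \<B>(2) that] by auto
    show ?thesis
    proof (cases "full U")
      case True
      then have "emeasure M ?S = emeasure M A" using A S unfolding granule_def full_def by blast
      moreover have "emeasure M A \<noteq> \<infinity>" using A by (auto simp: granule_def)
      ultimately have "emeasure M (A - ?S) = 0"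
        using Asets S by (subst emeasure_Diff) auto
      then have "AE t in M. t \<notin> A - ?S" using Asets S by (intro AE_not_in) auto
      then show ?thesis using AE_space by eventually_elim (use True in auto)
    next
      case False
      then have "AE t in M. t \<notin> ?S" using S by (intro AE_not_in) (auto simp: full_def)
      then show ?thesis using AE_space by eventually_elim (use False in auto)
    qed
  qed
  then have AE: "AE t in M. \<forall>U\<in>\<B>. t \<in> A \<longrightarrow> (f t \<in> U \<longleftrightarrow> full U)"
    unfolding AE_ball_countable[OF \<B>(1)] by blast
  \<comment> \<open>A point outside the exceptional set exists because \<open>A\<close> is not null;
    its value is the constant.\<close>
  have "\<exists>t\<in>A. \<forall>U\<in>\<B>. f t \<in> U \<longleftrightarrow> full U"
  proof (rule ccontr)
    assume "\<not> ?thesis"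
    with AE have "AE t in M. t \<notin> A" by (elim eventually_mono) blast
    then have "A \<in> null_sets M" using AE_iff_null_sets[OF Asets] by blast
    then show False using False by auto
  qed
  then obtain t0 where "t0 \<in> A" and t0: "\<forall>U\<in>\<B>. f t0 \<in> U \<longleftrightarrow> full U" by (rule bexE)
  have "AE t in M. t \<in> A \<longrightarrow> f t = f t0"
  proof (rule eventually_mono[OF AE])
    fix t assume elim: "\<forall>U\<in>\<B>. t \<in> A \<longrightarrow> (f t \<in> U \<longleftrightarrow> full U)"
    show "t \<in> A \<longrightarrow> f t = f t0"
    proof (rule impI, rule ccontr)
      assume t: "t \<in> A" and ne: "f t \<noteq> f t0"
      from t1_space[OF ne] obtain U where U: "open U" "f t \<in> U" "f t0 \<notin> U" by auto
      from U(1,2) obtain B where B: "B \<in> \<B>" "f t \<in> B" "B \<subseteq> U" by (rule topological_basisE[OF \<B>(2)])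
      have "full B" using elim t B by auto
      then have "f t0 \<in> B" using t0 B(1) by auto
      then show False using U(3) B(3) by auto
    qed
  qed
  then show ?thesis by blast
qed

text \<open>The support of an integrable function is a countable union of sets of finite measure,
  each covered by countably many atoms up to a null set. Collecting the atoms of all functions in
  \<open>F\<close> and making them disjoint gives one family that serves all of \<open>F\<close>;
  the pieces remain granules, though some may be null.\<close>

lemma purely_atomic_support:
  fixes F :: "('a \<Rightarrow> 'b::{real_normed_vector,second_countable_topology,banach}) set"
  assumes pa: "purely_atomic M" and F: "countable F" "\<And>f. f \<in> F \<Longrightarrow> integrable M f"
  obtains B :: "nat \<Rightarrow> 'a set" where "disjoint_family B" "\<And>k. granule M (B k)"
    "\<And>f. f \<in> F \<Longrightarrow> AE t in M. t \<notin> (\<Union>k. B k) \<longrightarrow> f t = 0"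
proof -
  define E where "E f m = {t \<in> space M. 1 / (real m + 1) \<le> norm (f t)}" for f :: "'a \<Rightarrow> 'b" and m
  have Esets: "E f m \<in> sets M" if "f \<in> F" for f m
    using F(2)[OF that] unfolding E_def by measurable
  have "\<exists>\<A>. countable \<A> \<and> (\<forall>A\<in>\<A>. granule M A) \<and> E f m - \<Union>\<A> \<in> null_sets M" if f: "f \<in> F" for f m
  proof (cases "emeasure M (E f m) = 0")
    case True
    then show ?thesis using Esets[OF f] by (intro exI[of _ "{}"]) auto
  next
    case False
    \<comment> \<open>Markov's inequality bounds the measure, as pure atomicity only applies to sets
      of finite measure.\<close>
    have "emeasure M (E f m) \<le> ennreal (1 / (1 / (real m + 1)) * (\<integral>t. norm (f t) \<partial>M))"
      unfolding E_def using F(2)[OF f]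
      by (intro integral_Markov_inequality) auto
    then have "emeasure M (E f m) < \<infinity>"
      by (auto simp: ennreal_less_top intro: order.strict_trans1)
    then have "purely_atomic_set M (E f m)"
      using pa False Esets[OF f] by (simp add: purely_atomic_def zero_less_iff_neq_zero)
    then obtain \<A> where \<A>: "countable \<A>" "\<forall>A\<in>\<A>. atom M A \<and> A \<subseteq> E f m"
      "(E f m - \<Union>\<A>) \<union> (\<Union>\<A> - E f m) \<in> null_sets M"
      by (auto simp: purely_atomic_set_def)
    have "\<Union>\<A> \<in> sets M" using \<A> by (intro sets.countable_Union) (auto simp: atom_def)
    then have "E f m - \<Union>\<A> \<in> null_sets M"
      using \<A>(3) Esets[OF f] by (intro null_sets_subset[OF \<A>(3)]) auto
    then show ?thesis
      using \<A>(1,2) granule_atom by (intro exI[of _ \<A>] conjI ballI) auto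
  qed
  then have "\<forall>f\<in>F. \<exists>\<A>. \<forall>m. countable (\<A> m) \<and> (\<forall>A\<in>\<A> m. granule M A) \<and>
      E f m - \<Union>(\<A> m) \<in> null_sets M"
    by (intro ballI choice allI)
  from bchoice[OF this] obtain \<A> where "\<forall>f\<in>F. \<forall>m. countable (\<A> f m) \<and>
      (\<forall>A\<in>\<A> f m. granule M A) \<and> E f m - \<Union>(\<A> f m) \<in> null_sets M" ..
  then have \<A>: "\<And>f m. f \<in> F \<Longrightarrow> countable (\<A> f m)"
    "\<And>f m A. f \<in> F \<Longrightarrow> A \<in> \<A> f m \<Longrightarrow> granule M A"
    "\<And>f m. f \<in> F \<Longrightarrow> E f m - \<Union>(\<A> f m) \<in> null_sets M"
    by blast+
  define D where "D = insert {} (\<Union>f\<in>F. \<Union>m. \<A> f m)"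
  have D: "countable D" "D \<noteq> {}" using F(1) \<A>(1) by (auto simp: D_def)
  define A where "A = from_nat_into D"
  have A: "range A = D" unfolding A_def using D by (simp add: range_from_nat_into)
  have gr: "granule M (A k)" for k
  proof -
    have "A k \<in> D" using A by blast
    then show ?thesis using \<A>(2) granule_empty by (auto simp: D_def)
  qed
  then have "range A \<subseteq> sets M" by (auto simp: granule_def)
  then have dsets: "disjointed A k \<in> sets M" for k using sets.range_disjointed_sets by blast
  show ?thesis
  proof (rule that[of "disjointed A"])
    show "disjoint_family (disjointed A)" by (rule disjoint_family_disjointed)
    show "granule M (disjointed A k)" for k
      by (rule granule_subset[OF gr dsets disjointed_subset])
    fix f assume f: "f \<in> F"
    have "AE t in M. \<forall>m. t \<notin> E f m - \<Union>(\<A> f m)"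
      unfolding AE_all_countable using AE_not_in[OF \<A>(3)[OF f]] by blast
    then show "AE t in M. t \<notin> (\<Union>k. disjointed A k) \<longrightarrow> f t = 0"
      using AE_space
    proof eventually_elim
      case (elim t)
      show ?case
      proof (rule impI, rule ccontr)
        assume t: "t \<notin> (\<Union>k. disjointed A k)" and "f t \<noteq> 0"
        then obtain m where "inverse (real (Suc m)) < norm (f t)" using reals_Archimedean[of "norm (f t)"] by auto
        then have "t \<in> E f m" using elim(2) by (simp add: E_def inverse_eq_divide add.commute)
        then have "t \<in> \<Union>(\<A> f m)" using elim(1) by blast
        then have "t \<in> \<Union>D" using f by (auto simp: D_def)
        then show False using t A by (auto simp: UN_disjointed_eq)
      qed
    qed
  qed
qed

section \<open>Strict convexity\<close>

text \<open>Equality in the triangle inequality forces equal directions. Strict convexity speaks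
  about unit vectors, so the shorter length is split off from both vectors.\<close>

lemma strictly_convex_parallel:
  fixes a b :: "'y::real_normed_vector"
  assumes sc: "strictly_convex TYPE('y)" and eq: "norm (a + b) = norm a + norm b" and a: "a \<noteq> 0"
  shows "\<exists>c::real. a + b = c *\<^sub>R a"
proof (cases "b = 0")
  case True
  then show ?thesis by (intro exI[of _ 1]) simp
next
  case False
  define u where "u = a /\<^sub>R norm a"
  define v where "v = b /\<^sub>R norm b"
  have uv: "norm u = 1" "norm v = 1" "a = norm a *\<^sub>R u" "b = norm b *\<^sub>R v"
    using a False by (auto simp: u_def v_def)
  have "u = v"
  proof (rule ccontr)
    assume "u \<noteq> v"
    then have lt: "norm (u + v) < 2" using sc uv unfolding strictly_convex_def by blast
    \<comment> \<open>The common length \<open>m\<close> carries the strict inequality for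
      \<open>u + v\<close>; what is left of \<open>a\<close> and \<open>b\<close> only meets the
      ordinary triangle inequality.\<close>
    define m where "m = min (norm a) (norm b)"
    have m: "0 < m" using a False by (simp add: m_def)
    have "a + b = m *\<^sub>R (u + v) + (norm a - m) *\<^sub>R u + (norm b - m) *\<^sub>R v"
      using uv(3,4) by (simp add: algebra_simps)
    then have "norm (a + b) \<le> norm (m *\<^sub>R (u + v)) + norm ((norm a - m) *\<^sub>R u) + norm ((norm b - m) *\<^sub>R v)"
      by (metis norm_triangle_mono norm_triangle_ineq order_refl)
    also have "\<dots> = m * norm (u + v) + (norm a - m) + (norm b - m)"
      using m uv(1,2) by (simp add: m_def)
    also have "\<dots> < m * 2 + (norm a - m) + (norm b - m)"
      using m lt by simp
    finally show False using eq by simp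
  qed
  then have "b = (norm b / norm a) *\<^sub>R a" using uv(4) by (metis u_def scaleR_scaleR divide_inverse)
  then have "a + b = (1 + norm b / norm a) *\<^sub>R a" by (simp add: scaleR_add_left)
  then show ?thesis by blast
qed

text \<open>Group the series as the term \<open>z j\<close> and the remainder
  \<open>s - z j\<close>. The remainder has norm at most \<open>norm s - norm (z j)\<close>, so the
  two-term case applies to this pair.\<close>

lemma strictly_convex_sums_parallel:
  fixes z :: "nat \<Rightarrow> 'y::real_normed_vector"
  assumes sc: "strictly_convex TYPE('y)" and z: "z sums s" "(\<lambda>i. norm (z i)) sums norm s"
    and j: "z j \<noteq> 0"
  shows "\<exists>c::real. s = c *\<^sub>R z j"
proof -
  have "norm ((\<Sum>i<n. z i) - z j) \<le> (\<Sum>i<n. norm (z i)) - norm (z j)" if "j < n" for n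
  proof -
    have "(\<Sum>i<n. z i) - z j = (\<Sum>i\<in>{..<n} - {j}. z i)"
      using that by (subst sum.remove[of _ j]) auto
    also have "norm \<dots> \<le> (\<Sum>i\<in>{..<n} - {j}. norm (z i))" by (rule norm_sum)
    also have "\<dots> = (\<Sum>i<n. norm (z i)) - norm (z j)"
      using that by (subst (2) sum.remove[of _ j]) auto
    finally show ?thesis .
  qed
  then have "\<forall>\<^sub>F n in sequentially. norm ((\<Sum>i<n. z i) - z j) \<le> (\<Sum>i<n. norm (z i)) - norm (z j)"
    by (intro eventually_sequentiallyI[of "Suc j"]) auto
  moreover have "(\<lambda>n. norm ((\<Sum>i<n. z i) - z j)) \<longlonglongrightarrow> norm (s - z j)"
    using z(1) unfolding sums_def by (intro tendsto_intros)
  moreover have "(\<lambda>n. (\<Sum>i<n. norm (z i)) - norm (z j)) \<longlonglongrightarrow> norm s - norm (z j)"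
    using z(2) unfolding sums_def by (intro tendsto_intros)
  ultimately have "norm (s - z j) \<le> norm s - norm (z j)"
    by (intro tendsto_le[of sequentially]) auto
  moreover have "norm s \<le> norm (z j) + norm (s - z j)"
    using norm_triangle_ineq[of "z j" "s - z j"] by simp
  ultimately have "norm (z j + (s - z j)) = norm (z j) + norm (s - z j)" by simp
  from strictly_convex_parallel[OF sc this j] show ?thesis by simp
qed

context L1_tensor
begin

section \<open>A tensor that does not attain its norm\<close>

text \<open>The sum of the pointwise norms dominates \<open>norm (tfun w t)\<close> and has the same
  integral by attainment, so both agree almost everywhere.\<close>

lemma attaining_representation_pointwise:
  assumes w: "wf_rep w" and f: "\<And>i. integrable M (f i)"
    and lim: "(\<lambda>n. tdist (tsum f y n) w) \<longlonglongrightarrow> 0"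
    and sums: "(\<lambda>i. (\<integral>t. norm (f i t) \<partial>M) * norm (y i)) sums tnorm w"
  shows "AE t in M. (\<lambda>i. sc (f i t) (y i)) sums tfun w t \<and>
    (\<lambda>i. norm (sc (f i t) (y i))) sums norm (tfun w t)"
proof -
  define h where "h i t = norm (f i t) * norm (y i)" for i t
  have h: "integrable M (h i)" for i unfolding h_def using f by auto
  have hint: "(\<integral>t. h i t \<partial>M) = (\<integral>t. norm (f i t) \<partial>M) * norm (y i)" for i
    by (simp add: h_def)
  have h0: "0 \<le> h i t" for i t by (simp add: h_def)
  have "(\<integral>\<^sup>+t. (\<Sum>i. ennreal (h i t)) \<partial>M) = (\<Sum>i. \<integral>\<^sup>+t. ennreal (h i t) \<partial>M)"
    using h by (intro nn_integral_suminf) auto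
  also have "\<dots> = (\<Sum>i. ennreal ((\<integral>t. norm (f i t) \<partial>M) * norm (y i)))"
    using h h0 by (simp add: nn_integral_eq_integral hint)
  also have "\<dots> = ennreal (tnorm w)" by (rule suminf_ennreal_eq[OF _ sums]) simp
  finally have nn: "(\<integral>\<^sup>+t. (\<Sum>i. ennreal (h i t)) \<partial>M) = ennreal (tnorm w)" .
  have "AE t in M. (\<Sum>i. ennreal (h i t)) \<noteq> \<infinity>"
    using h by (intro nn_integral_PInf_AE) (auto simp: nn)
  then have summ: "AE t in M. summable (\<lambda>i. h i t)"
    by eventually_elim (auto intro: summable_suminf_not_top h0)
  have summ': "AE t in M. summable (\<lambda>i. norm (h i t))" "summable (\<lambda>i. \<integral>t. norm (h i t) \<partial>M)"
    using summ sums by (simp_all add: h0 hint sums_iff)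
  have G: "integrable M (\<lambda>t. \<Sum>i. h i t)" "(\<integral>t. (\<Sum>i. h i t) \<partial>M) = tnorm w"
    using integrable_suminf[OF h summ'] integral_suminf[OF h summ'] sums by (simp_all add: hint sums_iff)
  have fin: "AE t in M. \<forall>n. tfun (tsum f y n) t = (\<Sum>i\<le>n. sc (f i t) (y i))"
  proof -
    have "AE t in M. \<forall>i. tfun {#(cls (f i), y i)#} t = sc (f i t) (y i)"
      unfolding AE_all_countable by (intro allI tfun_cls f)
    then show ?thesis by eventually_elim (simp only: tfun_sum[OF finite_atMost], blast)
  qed
  \<comment> \<open>Convergence in mean gives pointwise convergence along a subsequence only.
    Absolute summability provides a limit of the full series, which the subsequence identifies as
    \<open>tfun w t\<close>.\<close>
  obtain r where r: "strict_mono r"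
    and sub: "AE t in M. (\<lambda>n. norm (tfun (tsum f y (r n)) t - tfun w t)) \<longlonglongrightarrow> 0"
    using tendsto_L1_AE_subseq[of M "\<lambda>n t. norm (tfun (tsum f y n) t - tfun w t)"]
      tdist_integral[OF wf_tsum[OF f] w] lim by auto
  have conv: "AE t in M. (\<lambda>i. sc (f i t) (y i)) sums tfun w t"
    using fin sub summ
  proof eventually_elim
    case (elim t)
    have "summable (\<lambda>i. norm (sc (f i t) (y i)))"
      using elim(3) by (simp add: norm_sc h_def)
    then have "summable (\<lambda>i. sc (f i t) (y i))"
      by (rule summable_norm_cancel)
    then have "(\<lambda>n. \<Sum>i\<le>n. sc (f i t) (y i)) \<longlonglongrightarrow> (\<Sum>i. sc (f i t) (y i))"
      by (rule summable_LIMSEQ')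
    then have "(\<lambda>n. \<Sum>i\<le>r n. sc (f i t) (y i)) \<longlonglongrightarrow> (\<Sum>i. sc (f i t) (y i))"
      using LIMSEQ_subseq_LIMSEQ[OF _ r] by (simp add: o_def)
    moreover have "(\<lambda>n. \<Sum>i\<le>r n. sc (f i t) (y i)) \<longlonglongrightarrow> tfun w t"
      using LIM_zero_cancel[OF tendsto_norm_zero_cancel[OF elim(2)]] elim(1) by simp
    ultimately have "(\<Sum>i. sc (f i t) (y i)) = tfun w t" by (rule LIMSEQ_unique)
    then show ?case using \<open>summable (\<lambda>i. sc (f i t) (y i))\<close> by (auto simp: sums_iff)
  qed
  have le: "AE t in M. norm (tfun w t) \<le> (\<Sum>i. h i t)"
    using conv summ
  proof eventually_elim
    case (elim t)
    have "summable (\<lambda>i. norm (sc (f i t) (y i)))" using elim(2) by (simp add: norm_sc h_def)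
    from summable_norm[OF this] elim(1) show ?case by (simp add: norm_sc h_def sums_iff)
  qed
  have int: "integrable M (\<lambda>t. (\<Sum>i. h i t) - norm (tfun w t))"
    using G(1) integrable_norm_tfun[OF w] by (rule Bochner_Integration.integrable_diff)
  have "(\<integral>t. (\<Sum>i. h i t) - norm (tfun w t) \<partial>M) = 0"
    using G integrable_norm_tfun[OF w] by (subst Bochner_Integration.integral_diff) (auto simp: tnorm_def)
  then have "AE t in M. (\<Sum>i. h i t) - norm (tfun w t) = 0"
    using le by (subst integral_nonneg_eq_0_iff_AE[symmetric, OF int]) auto
  then show ?thesis
    using conv summ by eventually_elim (simp add: norm_sc h_def sums_iff)
qed

lemma exists_not_attaining:
  assumes npa: "\<not> purely_atomic M" and convex: "strictly_convex TYPE('y)" and dim: "dim_at_least 2 sc"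
  shows "\<exists>u\<in>vcarrier (proj_tensor (L1 M) (nspace_of sc)). \<not> attains_proj_norm (L1 M) (nspace_of sc) u"
proof -
  obtain y1 y2 where "y1 \<noteq> y2" "independent {y1, y2}"
    using dim unfolding dim_at_least_def by (metis card_2_iff)
  then have indep: "a = 0 \<and> b = 0" if "sc a y1 + sc b y2 = 0" for a b
    using independentD[of "{y1, y2}" "{y1, y2}" "\<lambda>v. if v = y1 then a else b" y1]
      independentD[of "{y1, y2}" "{y1, y2}" "\<lambda>v. if v = y1 then a else b" y2] that by auto
  obtain R and g :: "'a \<Rightarrow> real" where R: "R \<in> sets M" "0 < emeasure M R" "emeasure M R < \<infinity>"
    and g: "g \<in> borel_measurable M" "\<And>t. \<bar>g t\<bar> \<le> 2" and level: "\<And>c. {t\<in>R. g t = c} \<in> null_sets M"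
    using not_purely_atomic_null_level_sets[OF npa] by blast
  define f1 :: "'a \<Rightarrow> 'k" where "f1 = indicator R"
  define f2 :: "'a \<Rightarrow> 'k" where "f2 t = of_real (g t) * indicator R t" for t
  have f1: "integrable M f1" unfolding f1_def by (rule integrable_indicator_field[OF R(1,3)])
  have "f2 \<in> borel_measurable M"
    unfolding f2_def[abs_def] using g(1) R(1)
    by (intro borel_measurable_times borel_measurable_indicator) auto
  moreover have "norm (f2 t) \<le> norm (2 * f1 t)" for t
    using g(2)[of t] by (auto simp: f1_def f2_def split: split_indicator)
  moreover have "integrable M (\<lambda>t. 2 * f1 t)" using f1 by simp
  ultimately have f2: "integrable M f2"
    by (intro Bochner_Integration.integrable_bound[of M "\<lambda>t. 2 * f1 t" f2]) auto
  define w where "w = {#(cls f1, y1)#} + {#(cls f2, y2)#}"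
  have w: "wf_rep w" by (simp add: w_def L1_class_in_carrier f1 f2)
  have tw: "AE t in M. tfun w t = sc (f1 t) y1 + sc (f2 t) y2"
    using tfun_cls[OF f1, of y1] tfun_cls[OF f2, of y2] by eventually_elim (simp only: w_def tfun_plus)
  \<comment> \<open>The counterexample comes from the algebraic tensor product, so its Cauchy
    sequence is constant and limits along it are trivial.\<close>
  have c: "vcauchy alg (\<lambda>_::nat. tclass w)" using w by (intro alg.vcauchy_const) (auto simp: alg_carrier)
  have "\<not> attains_proj_norm (L1 M) (nspace_of sc) (cauchy_class alg (\<lambda>_. tclass w))"
  proof
    assume "attains_proj_norm (L1 M) (nspace_of sc) (cauchy_class alg (\<lambda>_. tclass w))"
    then obtain f y d where f: "\<And>i. integrable M (f i)"
      and d: "\<And>n. (\<lambda>m::nat. tdist (tsum f y n) w) \<longlonglongrightarrow> d n" "d \<longlonglongrightarrow> 0"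
      and sums: "(\<lambda>i. (\<integral>t. norm (f i t) \<partial>M) * norm (y i)) sums tnorm w"
      unfolding attains_proj_norm_iff[OF w c tendsto_const] by blast
    have "d = (\<lambda>n. tdist (tsum f y n) w)"
      using LIMSEQ_unique[OF d(1) tendsto_const] by blast
    then have lim: "(\<lambda>n. tdist (tsum f y n) w) \<longlonglongrightarrow> 0" using d(2) by simp
    text \<open>Each fixed direction \<open>y i\<close> is met by \<open>y1 + s y2\<close> for at most one \<open>s\<close>.\<close>
    define dir where "dir i s \<longleftrightarrow> (\<exists>l. sc 1 y1 + sc (of_real s) y2 = sc l (y i))" for i and s :: real
    have dir_unique: "s = s'" if "dir i s" "dir i s'" for i s s'
    proof -
      obtain l l' where l: "sc 1 y1 + sc (of_real s) y2 = sc l (y i)"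
        and l': "sc 1 y1 + sc (of_real s') y2 = sc l' (y i)"
        using \<open>dir i s\<close> \<open>dir i s'\<close> unfolding dir_def by blast
      \<comment> \<open>Cross-multiplication eliminates the common direction
        \<open>y i\<close>.\<close>
      have "sc l' (sc 1 y1 + sc (of_real s) y2) = sc l (sc 1 y1 + sc (of_real s') y2)"
        unfolding l l' by (simp add: mult.commute)
      then have "sc (l' - l) y1 + sc (l' * of_real s - l * of_real s') y2 = 0"
        by (simp add: scale_right_distrib scale_left_diff_distrib algebra_simps)
      from indep[OF this] have e: "l' = l" "l' * of_real s = l * of_real s'" by auto
      \<comment> \<open>Otherwise \<open>y1 + s y2\<close> would vanish, against
        independence.\<close>
      moreover have "l \<noteq> 0" using l indep[of 1 "of_real s"] by auto
      ultimately show ?thesis by simp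
    qed
    \<comment> \<open>The chosen number is the only value that \<open>y i\<close> can serve. If
      there is none, the choice is arbitrary, but its level set is null all the same.\<close>
    have "AE t in M. \<forall>i. t \<notin> {t\<in>R. g t = (SOME s. dir i s)}"
      unfolding AE_all_countable by (intro allI AE_not_in level)
    then have "AE t in M. t \<notin> R"
      using tw attaining_representation_pointwise[OF w f lim sums]
    proof eventually_elim
      case (elim t)
      show ?case
      proof
        assume t: "t \<in> R"
        have tf: "tfun w t = sc 1 y1 + sc (of_real (g t)) y2"
          using t elim(2) by (simp add: f1_def f2_def)
        then have nz: "tfun w t \<noteq> 0" using indep[of 1 "of_real (g t)"] by auto
        have "(\<Sum>i. sc (f i t) (y i)) = tfun w t" using elim(3) by (simp add: sums_iff)
        moreover have "(\<Sum>i. sc (f i t) (y i)) = 0" if "\<And>i. sc (f i t) (y i) = 0"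
          by (simp only: that suminf_zero)
        ultimately obtain i where i: "sc (f i t) (y i) \<noteq> 0" using nz by force
        obtain c :: real where "tfun w t = c *\<^sub>R sc (f i t) (y i)"
          using strictly_convex_sums_parallel[OF convex conjunct1[OF elim(3)] conjunct2[OF elim(3)] i] ..
        then have "tfun w t = sc (of_real c * f i t) (y i)"
          by (simp only: scale_real[symmetric] scale_scale)
        then have "dir i (g t)" unfolding dir_def tf by blast
        then have "g t = (SOME s. dir i s)" using dir_unique someI[of "dir i"] by blast
        then show False using elim(1) t by blast
      qed
    qed
    then have "R \<in> null_sets M" using AE_iff_null_sets[OF R(1)] by blast
    then show False using R(2) by auto
  qed
  moreover have "cauchy_class alg (\<lambda>_. tclass w) \<in> vcarrier (proj_tensor (L1 M) (nspace_of sc))"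
    using c by (auto simp: proj_tensor_def vcompletion_def)
  ultimately show ?thesis by blast
qed

end

section \<open>Tensors over purely atomic measures\<close>

text \<open>Completeness of l1(Y), stated for sequences of which only the differences are known to
  be summable, since those are the distances between tensors.\<close>

lemma l1_complete:
  fixes a :: "nat \<Rightarrow> nat \<Rightarrow> 'y::banach"
  assumes D: "\<And>m n. (\<lambda>k. norm (a m k - a n k)) sums D m n"
    and cauchy: "\<And>e. 0 < e \<Longrightarrow> \<exists>N. \<forall>m\<ge>N. \<forall>n\<ge>N. D m n < e"
  obtains b where "\<And>n. summable (\<lambda>k. norm (b k - a n k))"
    "(\<lambda>n. \<Sum>k. norm (b k - a n k)) \<longlonglongrightarrow> 0"
proof -
  have "Cauchy (\<lambda>n. a n k)" for k
  proof (rule metric_CauchyI)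
    fix e :: real assume "0 < e"
    then obtain N where N: "\<forall>m\<ge>N. \<forall>n\<ge>N. D m n < e" using cauchy by blast
    have "norm (a m k - a n k) \<le> D m n" for m n
      using sum_le_suminf[of "\<lambda>k. norm (a m k - a n k)" "{k}"] D[of m n] by (simp add: sums_iff)
    then show "\<exists>N. \<forall>m\<ge>N. \<forall>n\<ge>N. dist (a m k) (a n k) < e"
      using N unfolding dist_norm by (metis order.strict_trans1)
  qed
  then have "\<exists>l. (\<lambda>n. a n k) \<longlonglongrightarrow> l" for k using Cauchy_convergent convergentD by blast
  then obtain b where b: "\<And>k. (\<lambda>n. a n k) \<longlonglongrightarrow> b k" by metis
  \<comment> \<open>Finite partial sums pass to the coordinatewise limit, and the bound does not
    depend on their length.\<close>
  have partial: "(\<Sum>k<K. norm (b k - a n k)) \<le> e" if N: "\<forall>m\<ge>N. D m n \<le> e" for K n e N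
  proof (rule LIMSEQ_le_const2)
    show "(\<lambda>m. \<Sum>k<K. norm (a m k - a n k)) \<longlonglongrightarrow> (\<Sum>k<K. norm (b k - a n k))"
      by (intro tendsto_intros b)
    have "(\<Sum>k<K. norm (a m k - a n k)) \<le> e" if "m \<ge> N" for m
      using sum_le_suminf[of "\<lambda>k. norm (a m k - a n k)" "{..<K}"] D[of m n] N that
      by (fastforce simp: sums_iff)
    then show "\<exists>N. \<forall>m\<ge>N. (\<Sum>k<K. norm (a m k - a n k)) \<le> e" by blast
  qed
  have tail: "summable (\<lambda>k. norm (b k - a n k))" "(\<Sum>k. norm (b k - a n k)) \<le> e"
    if "\<forall>m\<ge>N. D m n \<le> e" for n e N
  proof -
    show s: "summable (\<lambda>k. norm (b k - a n k))"
      using partial[OF that] by (intro summableI_nonneg_bounded) auto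
    show "(\<Sum>k. norm (b k - a n k)) \<le> e"
      using partial[OF that] by (intro suminf_le_const s)
  qed
  have D0: "0 \<le> D m n" for m n
    using D[of m n] suminf_nonneg[of "\<lambda>k. norm (a m k - a n k)"] by (auto simp: sums_iff)
  show ?thesis
  proof (rule that)
    \<comment> \<open>One late index \<open>N\<close> gives a summable difference to
      \<open>b\<close>; adding the summable difference between \<open>a N\<close> and
      \<open>a n\<close> reaches every \<open>n\<close>.\<close>
    obtain N where N: "\<forall>m\<ge>N. \<forall>n\<ge>N. D m n < 1" using cauchy[of 1] by auto
    have "summable (\<lambda>k. norm (b k - a N k))"
      using N by (intro tail[of N N 1]) (simp add: less_imp_le)
    then show summ: "summable (\<lambda>k. norm (b k - a n k))" for n
    proof (rule summable_comparison_test'[OF summable_add[OF _ sums_summable[OF D[of N n]]], of _ 0])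
      show "norm (norm (b k - a n k)) \<le> norm (b k - a N k) + norm (a N k - a n k)" for k
        using norm_triangle_ineq[of "b k - a N k" "a N k - a n k"] by simp
    qed
    show "(\<lambda>n. \<Sum>k. norm (b k - a n k)) \<longlonglongrightarrow> 0"
    proof (rule metric_LIMSEQ_I)
      fix e :: real assume "0 < e"
      then obtain N where N: "\<forall>m\<ge>N. \<forall>n\<ge>N. D m n < e / 2" using cauchy[of "e / 2"] by auto
      have "dist (\<Sum>k. norm (b k - a n k)) 0 < e" if "n \<ge> N" for n
      proof -
        have "(\<Sum>k. norm (b k - a n k)) \<le> e / 2"
          using N that by (intro tail[of N n]) (simp add: less_imp_le)
        moreover have "0 \<le> (\<Sum>k. norm (b k - a n k))" using summ by (intro suminf_nonneg) auto
        ultimately show ?thesis using \<open>0 < e\<close> by simp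
      qed
      then show "\<exists>N. \<forall>n\<ge>N. dist (\<Sum>k. norm (b k - a n k)) 0 < e" by blast
    qed
  qed
qed

text \<open>By the reverse triangle inequality, \<open>D n\<close> and \<open>T\<close> differ by at
  most the distance from \<open>a n\<close> to \<open>b\<close>. Taking \<open>c\<close> to be zero
  gives convergence of norms, taking it to be a partial sum gives the distances in
  \<open>attains_proj_norm_iff\<close>.\<close>

lemma l1_dist_tendsto:
  fixes a :: "nat \<Rightarrow> nat \<Rightarrow> 'y::real_normed_vector"
  assumes summ: "\<And>n. summable (\<lambda>k. norm (b k - a n k))"
    and lim: "(\<lambda>n. \<Sum>k. norm (b k - a n k)) \<longlonglongrightarrow> 0"
    and D: "\<And>n. (\<lambda>k. norm (c k - a n k)) sums D n"
    and T: "(\<lambda>k. norm (c k - b k)) sums T"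
  shows "D \<longlonglongrightarrow> T"
proof -
  have "norm (D n - T) \<le> (\<Sum>k. norm (b k - a n k))" for n
  proof -
    have "(\<lambda>k. norm (c k - a n k) - norm (c k - b k)) sums (D n - T)"
      using D T by (rule sums_diff)
    moreover have abs: "norm (norm (c k - a n k) - norm (c k - b k)) \<le> norm (b k - a n k)" for k
      using norm_triangle_ineq3[of "c k - a n k" "c k - b k"] by simp
    ultimately have "D n - T = (\<Sum>k. norm (c k - a n k) - norm (c k - b k))" by (simp add: sums_iff)
    moreover have s: "summable (\<lambda>k. norm (norm (c k - a n k) - norm (c k - b k)))"
      using abs by (intro summable_comparison_test'[OF summ[of n], of 0]) simp
    ultimately have "norm (D n - T) \<le> (\<Sum>k. norm (norm (c k - a n k) - norm (c k - b k)))"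
      using summable_norm[OF s] by simp
    also have "\<dots> \<le> (\<Sum>k. norm (b k - a n k))" by (rule suminf_le[OF abs s summ])
    finally show ?thesis .
  qed
  then have "(\<lambda>n. D n - T) \<longlonglongrightarrow> 0" by (intro Lim_null_comparison[OF _ lim] always_eventually allI)
  then show ?thesis by (rule LIM_zero_cancel)
qed

text \<open>At each point at most one summand of the step function is nonzero. Integrating in the
  extended nonnegative reals allows the exchange with the sum, and integrability of \<open>f\<close>
  brings the result back to the reals.\<close>

lemma integral_granules_sums:
  fixes f :: "'a \<Rightarrow> real"
  assumes B: "disjoint_family B" "\<And>k. B k \<in> sets M" "\<And>k. emeasure M (B k) < \<infinity>"
    and f: "integrable M f" and z: "\<And>k. 0 \<le> z k"
    and on: "\<And>k. AE t in M. t \<in> B k \<longrightarrow> f t = z k"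
    and off: "AE t in M. t \<notin> (\<Union>k. B k) \<longrightarrow> f t = 0"
  shows "(\<lambda>k. measure M (B k) * z k) sums (\<integral>t. f t \<partial>M)"
proof -
  have AE: "AE t in M. 0 \<le> f t \<and> ennreal (f t) = (\<Sum>k. ennreal (z k) * indicator (B k) t)"
  proof -
    have "AE t in M. \<forall>k. t \<in> B k \<longrightarrow> f t = z k" unfolding AE_all_countable using on by blast
    then show ?thesis
      using off
    proof eventually_elim
      case (elim t)
      show ?case
      proof (cases "t \<in> (\<Union>k. B k)")
        case True
        then obtain j where j: "t \<in> B j" by blast
        have "t \<in> B k \<longleftrightarrow> k = j" for k
          using j B(1) by (auto simp: disjoint_family_on_def)
        then have "(\<lambda>k. ennreal (z k) * indicator (B k) t) = (\<lambda>k. if k = j then ennreal (z j) else 0)"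
          by (auto simp: indicator_def)
        then show ?thesis
          using elim(1) j z[of j] sums_unique[OF sums_single[of j "\<lambda>k. ennreal (z j)"]] by simp
      next
        case False
        then show ?thesis using elim(2) by (auto simp: indicator_def)
      qed
    qed
  qed
  have "ennreal (\<integral>t. f t \<partial>M) = (\<integral>\<^sup>+t. ennreal (f t) \<partial>M)"
    using AE by (intro nn_integral_eq_integral[symmetric] f) (auto elim: eventually_mono)
  also have "\<dots> = (\<integral>\<^sup>+t. (\<Sum>k. ennreal (z k) * indicator (B k) t) \<partial>M)"
    using AE by (intro nn_integral_cong_AE) (auto elim: eventually_mono)
  also have "\<dots> = (\<Sum>k. \<integral>\<^sup>+t. ennreal (z k) * indicator (B k) t \<partial>M)"
    using B(2) by (intro nn_integral_suminf) auto
  also have "\<dots> = (\<Sum>k. ennreal (measure M (B k) * z k))"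
    using B(2,3) z
    by (simp add: nn_integral_cmult_indicator emeasure_eq_ennreal_measure ennreal_mult mult.commute less_top)
  finally have eq: "(\<Sum>k. ennreal (measure M (B k) * z k)) = ennreal (\<integral>t. f t \<partial>M)" by simp
  then have summ: "summable (\<lambda>k. measure M (B k) * z k)"
    using z by (intro summable_suminf_not_top) auto
  then have "ennreal (\<Sum>k. measure M (B k) * z k) = ennreal (\<integral>t. f t \<partial>M)"
    using eq z by (subst suminf_ennreal2[symmetric]) auto
  moreover have "0 \<le> (\<integral>t. f t \<partial>M)"
    using AE by (intro integral_nonneg_AE) (auto elim: eventually_mono)
  moreover have "0 \<le> (\<Sum>k. measure M (B k) * z k)" using summ z by (intro suminf_nonneg) auto
  ultimately show ?thesis using summ by (simp add: sums_iff)
qed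

section \<open>Tensors as absolutely summable sequences\<close>

context L1_tensor
begin

text \<open>Constancy is taken from the scalar coefficients, whose range has a countable basis, and
  then passed on to the finite sum with values in \<open>'y\<close>.\<close>

lemma tfun_granule:
  assumes "wf_rep w" "granule M A"
  shows "\<exists>c. AE t in M. t \<in> A \<longrightarrow> tfun w t = c"
  using assms(1)
proof (induction w)
  case (add p w)
  then obtain c where c: "AE t in M. t \<in> A \<longrightarrow> tfun w t = c" by auto
  have "integrable M (L1_rep (fst p))" using add.prems by (intro L1_carrier_rep) auto
  then have "L1_rep (fst p) \<in> borel_measurable M" by auto
  then obtain d where d: "AE t in M. t \<in> A \<longrightarrow> L1_rep (fst p) t = d"
    using granule_AE_const[OF assms(2)] by blast
  have "AE t in M. t \<in> A \<longrightarrow> tfun (add_mset p w) t = sc d (snd p) + c"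
    using c d by eventually_elim simp
  then show ?case by blast
qed auto

lemma tfun_support:
  assumes "\<And>p. p \<in># w \<Longrightarrow> AE t in M. t \<notin> U \<longrightarrow> L1_rep (fst p) t = 0"
  shows "AE t in M. t \<notin> U \<longrightarrow> tfun w t = 0"
  using assms
proof (induction w)
  case (add p w)
  then have "AE t in M. t \<notin> U \<longrightarrow> L1_rep (fst p) t = 0" "AE t in M. t \<notin> U \<longrightarrow> tfun w t = 0" by auto
  then show ?case by eventually_elim simp
qed simp

lemma purely_atomic_attains:
  assumes pa: "purely_atomic M" and u: "u \<in> vcarrier (proj_tensor (L1 M) (nspace_of sc))"
  shows "attains_proj_norm (L1 M) (nspace_of sc) u"
proof -
  obtain w where w: "\<And>n. wf_rep (w n)" and c: "vcauchy alg (\<lambda>n. tclass (w n))"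
    and u_eq: "u = cauchy_class alg (\<lambda>n. tclass (w n))"
    using proj_carrier_rep[OF u] by blast
  \<comment> \<open>All scalar functions of the whole sequence \<open>w\<close>; being countably
    many, they share one family of granules.\<close>
  define F where "F = (\<Union>n. (\<lambda>p. L1_rep (fst p)) ` set_mset (w n))"
  have "countable F"
    unfolding F_def by (intro countable_UN countable_image countable_finite[OF finite_set_mset]) auto
  moreover have "integrable M f" if "f \<in> F" for f
    using that w by (auto simp: F_def wf_rep_def intro!: L1_carrier_rep)
  ultimately obtain B :: "nat \<Rightarrow> 'a set" where B: "disjoint_family B" "\<And>k. granule M (B k)"
    and supp: "\<And>f. f \<in> F \<Longrightarrow> AE t in M. t \<notin> (\<Union>k. B k) \<longrightarrow> f t = 0"
    using purely_atomic_support[OF pa] by blast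
  have Bsets: "B k \<in> sets M" and Bfin: "emeasure M (B k) < \<infinity>" for k
    using B(2)[of k] by (auto simp: granule_def)
  define \<mu> where "\<mu> k = measure M (B k)" for k
  have \<mu>: "0 \<le> \<mu> k" for k by (simp add: \<mu>_def)
  have off: "AE t in M. t \<notin> (\<Union>k. B k) \<longrightarrow> tfun (w n) t = 0" for n
    by (intro tfun_support supp) (auto simp: F_def)
  have "\<forall>n k. \<exists>c. AE t in M. t \<in> B k \<longrightarrow> tfun (w n) t = c"
    using tfun_granule[OF w B(2)] by blast
  then obtain z where z: "\<And>n k. AE t in M. t \<in> B k \<longrightarrow> tfun (w n) t = z n k" by metis
  \<comment> \<open>The map from a tensor to its values weighted by \<open>\<mu> k\<close> is an
    isometry into l1(Y).\<close>
  have dist: "(\<lambda>k. norm (\<mu> k *\<^sub>R zv k - \<mu> k *\<^sub>R zw k)) sums tdist v v'"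
    if "wf_rep v" "wf_rep v'"
      and on: "\<And>k. AE t in M. t \<in> B k \<longrightarrow> tfun v t = zv k" "\<And>k. AE t in M. t \<in> B k \<longrightarrow> tfun v' t = zw k"
      and off: "AE t in M. t \<notin> (\<Union>k. B k) \<longrightarrow> tfun v t = 0" "AE t in M. t \<notin> (\<Union>k. B k) \<longrightarrow> tfun v' t = 0"
    for v v' zv zw
  proof -
    have "(\<lambda>k. measure M (B k) * norm (zv k - zw k)) sums (\<integral>t. norm (tfun v t - tfun v' t) \<partial>M)"
    proof (rule integral_granules_sums[OF B(1) Bsets Bfin tdist_integral(1)[OF that(1,2)]])
      show "AE t in M. t \<in> B k \<longrightarrow> norm (tfun v t - tfun v' t) = norm (zv k - zw k)" for k
        using on(1)[of k] on(2)[of k] by eventually_elim simp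
      show "AE t in M. t \<notin> (\<Union>k. B k) \<longrightarrow> norm (tfun v t - tfun v' t) = 0"
        using off by eventually_elim simp
    qed simp
    moreover have "measure M (B k) * norm (zv k - zw k) = norm (\<mu> k *\<^sub>R zv k - \<mu> k *\<^sub>R zw k)" for k
      using \<mu>[of k] by (simp add: \<mu>_def flip: scaleR_diff_right)
    ultimately show ?thesis by (simp add: tdist_integral(2)[OF that(1,2)])
  qed
  \<comment> \<open>On a null granule \<open>z n k\<close> is arbitrary; the weight removes this
    ambiguity.\<close>
  define a where "a n k = \<mu> k *\<^sub>R z n k" for n k
  have a_dist: "(\<lambda>k. norm (a m k - a n k)) sums tdist (w m) (w n)" for m n
    unfolding a_def by (intro dist w z off)
  have "\<exists>N. \<forall>m\<ge>N. \<forall>n\<ge>N. tdist (w m) (w n) < e" if "0 < e" for e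
    using c that unfolding vcauchy_alg_iff[OF w] by blast
  from l1_complete[OF a_dist this] obtain b where b: "\<And>n. summable (\<lambda>k. norm (b k - a n k))"
    "(\<lambda>n. \<Sum>k. norm (b k - a n k)) \<longlonglongrightarrow> 0" by blast
  \<comment> \<open>Norms are written as distances from zero so that \<open>l1_dist_tendsto\<close>
    covers them.\<close>
  have a_norm: "(\<lambda>k. norm (0 - a n k)) sums tnorm (w n)" for n
  proof -
    have "(\<lambda>k. norm (\<mu> k *\<^sub>R 0 - \<mu> k *\<^sub>R z n k)) sums tdist {#} (w n)"
      by (intro dist w z off) auto
    moreover have "tdist {#} (w n) = tnorm (w n)"
      using w by (simp add: tdist_integral(2) tnorm_def)
    ultimately show ?thesis by (simp add: a_def)
  qed
  have "summable (\<lambda>k. norm (b k))"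
  proof (rule summable_comparison_test'[OF summable_add[OF b(1)[of 0] sums_summable[OF a_norm[of 0]]], of 0])
    show "norm (norm (b k)) \<le> norm (b k - a 0 k) + norm (0 - a 0 k)" for k
      using norm_triangle_ineq[of "b k - a 0 k" "a 0 k"] by simp
  qed
  then obtain r where r: "(\<lambda>k. norm (b k)) sums r" by (auto simp: summable_def)
  have norm_lim: "(\<lambda>n. tnorm (w n)) \<longlonglongrightarrow> r"
    by (rule l1_dist_tendsto[OF b a_norm]) (simp add: r)
  define f :: "nat \<Rightarrow> 'a \<Rightarrow> 'k" where "f k = indicator (B k)" for k
  define y where "y k = b k /\<^sub>R \<mu> k" for k
  \<comment> \<open>On a null granule all \<open>a n k\<close> vanish, hence so does the limit, and
    undoing the weight in \<open>y\<close> loses nothing there.\<close>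
  have b0: "b k = 0" if "\<mu> k = 0" for k
  proof -
    have "norm (b k) \<le> (\<Sum>j. norm (b j - a n j))" for n
      using sum_le_suminf[OF b(1)[of n], of "{k}"] that by (simp add: a_def)
    then have "norm (b k) \<le> 0" by (intro LIMSEQ_le_const[OF b(2)]) auto
    then show ?thesis by simp
  qed
  have \<mu>y: "\<mu> k *\<^sub>R y k = b k" for k using b0[of k] by (cases "\<mu> k = 0") (simp_all add: y_def)
  have f: "integrable M (f k)" for k
    unfolding f_def by (rule integrable_indicator_field[OF Bsets Bfin])
  have fnorm: "(\<integral>t. norm (f k t) \<partial>M) = \<mu> k" for k
  proof -
    have "(\<integral>t. norm (f k t) \<partial>M) = (\<integral>t. indicator (B k) t \<partial>M)"
      by (intro Bochner_Integration.integral_cong) (auto simp: f_def split: split_indicator)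
    then show ?thesis using Bsets[of k] by (simp add: \<mu>_def)
  qed
  have tf: "AE t in M. tfun (tsum f y K) t = (\<Sum>i\<le>K. sc (f i t) (y i))" for K
  proof -
    have "AE t in M. \<forall>i. tfun {#(cls (f i), y i)#} t = sc (f i t) (y i)"
      unfolding AE_all_countable by (intro allI tfun_cls f)
    then show ?thesis by eventually_elim (simp only: tfun_sum[OF finite_atMost])
  qed
  \<comment> \<open>The value on \<open>B k\<close> of the partial sum up to \<open>K\<close>:
    disjointness leaves only the term with index \<open>k\<close>.\<close>
  define zs where "zs K k = (if k \<le> K then y k else 0)" for K k :: nat
  have "AE t in M. t \<in> B k \<longrightarrow> tfun (tsum f y K) t = zs K k" for k K
    using tf[of K]
  proof eventually_elim
    case (elim t)
    show ?case
    proof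
      assume t: "t \<in> B k"
      have "sc (f i t) (y i) = (if i = k then y i else 0)" for i
        using t B(1) by (auto simp: f_def disjoint_family_on_def split: split_indicator)
      then show "tfun (tsum f y K) t = zs K k" unfolding elim by (simp add: zs_def)
    qed
  qed
  moreover have "AE t in M. t \<notin> (\<Union>k. B k) \<longrightarrow> tfun (tsum f y K) t = 0" for K
    using tf[of K] by eventually_elim (auto simp: f_def)
  ultimately have s_dist: "(\<lambda>k. norm (\<mu> k *\<^sub>R zs K k - a n k)) sums tdist (tsum f y K) (w n)" for K n
    unfolding a_def by (intro dist wf_tsum f w z off)
  \<comment> \<open>The partial sum agrees with \<open>b\<close> up to index \<open>K\<close> and is
    zero afterwards, so its distance from \<open>b\<close> is the tail of the series for
    \<open>r\<close>.\<close>
  have T: "(\<lambda>k. norm (\<mu> k *\<^sub>R zs K k - b k)) sums (r - (\<Sum>k\<le>K. norm (b k)))" for K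
  proof -
    have "(\<lambda>k. norm (b k) - (if k \<in> {..K} then norm (b k) else 0)) sums (r - (\<Sum>k\<le>K. norm (b k)))"
      by (intro sums_diff r sums_If_finite_set) simp
    moreover have "norm (\<mu> k *\<^sub>R zs K k - b k) = norm (b k) - (if k \<in> {..K} then norm (b k) else 0)" for k
      by (simp add: zs_def \<mu>y)
    ultimately show ?thesis by simp
  qed
  have partial: "(\<lambda>n. tdist (tsum f y K) (w n)) \<longlonglongrightarrow> r - (\<Sum>k\<le>K. norm (b k))" for K
    by (rule l1_dist_tendsto[OF b s_dist T])
  have rest: "(\<lambda>K. r - (\<Sum>k\<le>K. norm (b k))) \<longlonglongrightarrow> 0"
    using tendsto_diff[OF tendsto_const[of r] r[unfolded sums_def_le]] by simp
  have total: "(\<lambda>k. (\<integral>t. norm (f k t) \<partial>M) * norm (y k)) sums r"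
  proof -
    have "(\<integral>t. norm (f k t) \<partial>M) * norm (y k) = norm (b k)" for k
      unfolding fnorm \<mu>y[symmetric] using \<mu>[of k] by simp
    then show ?thesis using r by simp
  qed
  show ?thesis
    unfolding u_eq attains_proj_norm_iff[OF w c norm_lim]
    by (intro exI[of _ f] exI[of _ y] exI[of _ "\<lambda>K. r - (\<Sum>k\<le>K. norm (b k))"] conjI allI
        f partial rest total)
qed

theorem NA_proj_eq_iff_purely_atomic:
  assumes "strictly_convex TYPE('y)" "dim_at_least 2 sc"
  shows "NA_proj (L1 M) (nspace_of sc) = vcarrier (proj_tensor (L1 M) (nspace_of sc)) \<longleftrightarrow> purely_atomic M"
  unfolding NA_proj_def using purely_atomic_attains exists_not_attaining[OF _ assms] by blast

end

theorem corollary3p9: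
  fixes M :: "'a measure"
    and scaleC :: "complex \<Rightarrow> 'z::banach \<Rightarrow> 'z"
  shows
    "(strictly_convex TYPE('y::banach) \<and> dim_at_least 2 ((*\<^sub>R) :: real \<Rightarrow> 'y \<Rightarrow> 'y) \<longrightarrow>
        (NA_proj (L1 M) (nspace_of ((*\<^sub>R) :: real \<Rightarrow> 'y \<Rightarrow> 'y))
           = vcarrier (proj_tensor (L1 M) (nspace_of ((*\<^sub>R) :: real \<Rightarrow> 'y \<Rightarrow> 'y)))
         \<longleftrightarrow> purely_atomic M))
     \<and>
     (complex_scaling scaleC \<and> strictly_convex TYPE('z) \<and> dim_at_least 2 scaleC \<longrightarrow>
        (NA_proj (L1 M) (nspace_of scaleC)
           = vcarrier (proj_tensor (L1 M) (nspace_of scaleC))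
         \<longleftrightarrow> purely_atomic M))"
proof (intro conjI impI)
  assume y: "strictly_convex TYPE('y) \<and> dim_at_least 2 ((*\<^sub>R) :: real \<Rightarrow> 'y \<Rightarrow> 'y)"
  interpret L1_tensor "(*\<^sub>R) :: real \<Rightarrow> 'y \<Rightarrow> 'y" M
    by unfold_locales (auto simp: algebra_simps)
  show "NA_proj (L1 M) (nspace_of ((*\<^sub>R) :: real \<Rightarrow> 'y \<Rightarrow> 'y))
      = vcarrier (proj_tensor (L1 M) (nspace_of ((*\<^sub>R) :: real \<Rightarrow> 'y \<Rightarrow> 'y))) \<longleftrightarrow> purely_atomic M"
    using y by (intro NA_proj_eq_iff_purely_atomic) auto
next
  assume z: "complex_scaling scaleC \<and> strictly_convex TYPE('z) \<and> dim_at_least 2 scaleC"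
  then interpret complex_scaling scaleC by simp
  interpret L1_tensor scaleC M
    by unfold_locales (simp_all add: scale_of_real norm_scale)
  show "NA_proj (L1 M) (nspace_of scaleC) = vcarrier (proj_tensor (L1 M) (nspace_of scaleC))
      \<longleftrightarrow> purely_atomic M"
    using z by (intro NA_proj_eq_iff_purely_atomic) auto
qed

end
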